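(* Let $b\in\mathbb{N}$ be an absolute constant with the property that for all $G\in\mathcal{A}$ and all $n\ge 2$, $$e_{bn}(G,L_2)\,\le\,\frac1n\sum_{k\ge n}a_k(G,L_2)$$ (such a constant exists). Assume that $F\in\mathcal{A}$ satisfies $$n^{\mathrm{all}}(\varepsilon,F)\,\le\,A\,\bigl(1+\ln\varepsilon^{-1}\bigr)^B$$ for some $B>0$ and $A\ge 1$ and all $\varepsilon\in(0,1)$. Then $$n^{\mathrm{std}}(\varepsilon,F)\,\le\,n^{\text{std-lin}}(\varepsilon,F)\,\le\,C\,\bigl(1+\ln\varepsilon^{-1}\bigr)^B$$ for all $\varepsilon\in(0,1)$, where $$C=3b\,A\,\bigl(\ln(36A)\,(1+B^3)\bigr)^B .$$
   Context: $\mathbb{N}=\{1,2,\dots\}$. The class $\mathcal{A}$ consists of all separable Banach spaces $F$ of real- or complex-valued functions defined on some nonempty set $\mathcal{D}$ such that function evaluation $f\mapsto f(x)$ is continuous on $F$ for each $x\in\mathcal{D}$ and $F$ is continuously embedded in $L_2=L_2(\mathcal{D},\mu)$ for some measure $\mu$ on $\mathcal{D}$ (the set $\mathcal{D}$ and the measure $\mu$ are part of the data associated with $F$). $B_F$ denotes the closed unit ball of $F$ and $F^*$ the space of continuous linear functionals on $F$. For $n\in\mathbb{N}$ define - the $n$-th linear sampling width $e_n(F,L_2):=\inf_{x_1,\dots,x_n\in\mathcal{D},\ \varphi_1,\dots,\varphi_n\in L_2}\ \sup_{f\in B_F}\bigl\|f-\sum_{i=1}^n f(x_i)\varphi_i\bigr\|_{L_2}$;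 - the $n$-th sampling width $g_n(F,L_2):=\inf_{x_1,\dots,x_n\in\mathcal{D},\ \phi\colon\mathbb{R}^n\to L_2}\ \sup_{f\in B_F}\bigl\|f-\phi(f(x_1),\dots,f(x_n))\bigr\|_{L_2}$, where $\phi$ is an arbitrary map; - the $n$-th linear width $a_n(F,L_2):=\inf_{T\colon L_2\to L_2,\ \mathrm{rank}(T)\le n}\ \sup_{f\in B_F}\|f-Tf\|_{L_2}$, where $T$ ranges over bounded linear operators of rank at most $n$; - the $n$-th Gelfand width $c_n(F,L_2):=\inf_{\phi\colon\mathbb{R}^n\to L_2,\ N\in(F^* )^n}\ \sup_{f\in B_F}\|f-\phi(N(f))\|_{L_2}$, where $\phi$ is an arbitrary map and $N(f)=(N_1(f),\dots,N_n(f))$. (For complex-valued functions, $\mathbb{R}^n$ is replaced by $\mathbb{C}^n$.) Define $n^{\mathrm{std}}(\varepsilon,F):=\min\{n: g_n(F,L_2)\le\varepsilon\}$, $n^{\text{std-lin}}(\varepsilon,F):=\min\{n: e_n(F,L_2)\le\varepsilon\}$ and $n^{\mathrm{all}}(\varepsilon,F):=\min\{n: c_n(F,L_2)\le\varepsilon\}$, with $n\in\mathbb{N}$ and $\min\emptyset=\infty$. *)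

theory Defs
  imports "HOL-Analysis.Analysis"
begin

text \<open>
  A function space on a set \<open>D\<close> together with a measure on \<open>D\<close>, where \<open>D\<close> is the space of the
  measure. The scalar field is recorded as a subset of the complex numbers, either \<open>\<real>\<close> or \<open>UNIV\<close>, so
  that spaces of real-valued and of complex-valued functions live in the same type: for \<open>\<real>\<close> all
  functions are real-valued on \<open>D\<close>, and \<open>L\<^sub>2\<close>, functionals, operators and information are real
  as well. Elements of a function space are represented by their extension by 0 outside \<open>D\<close>.
\<close>

record 'd fun_space =
  msr :: "'d measure"
  scal :: "complex set"
  elems :: "('d \<Rightarrow> complex) set"
  nrm :: "('d \<Rightarrow> complex) \<Rightarrow> real"

abbreviation dom_of :: "'d fun_space \<Rightarrow> 'd set" where
  "dom_of F \<equiv> space (msr F)"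

definition unit_ball :: "'d fun_space \<Rightarrow> ('d \<Rightarrow> complex) set" where
  "unit_ball F = {f \<in> elems F. nrm F f \<le> 1}"

definition normed_fun_space :: "'d fun_space \<Rightarrow> bool" where
  "normed_fun_space F \<longleftrightarrow>
     (scal F = \<real> \<or> scal F = UNIV) \<and>
     (\<forall>f\<in>elems F. (\<forall>x\<in>dom_of F. f x \<in> scal F) \<and> (\<forall>x. x \<notin> dom_of F \<longrightarrow> f x = 0)) \<and>
     (\<lambda>_. 0) \<in> elems F \<and>
     (\<forall>f\<in>elems F. \<forall>g\<in>elems F. (\<lambda>x. f x + g x) \<in> elems F) \<and>
     (\<forall>c\<in>scal F. \<forall>f\<in>elems F. (\<lambda>x. c * f x) \<in> elems F) \<and>
     (\<forall>f\<in>elems F. 0 \<le> nrm F f) \<and>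
     (\<forall>f\<in>elems F. nrm F f = 0 \<longleftrightarrow> f = (\<lambda>_. 0)) \<and>
     (\<forall>c\<in>scal F. \<forall>f\<in>elems F. nrm F (\<lambda>x. c * f x) = cmod c * nrm F f) \<and>
     (\<forall>f\<in>elems F. \<forall>g\<in>elems F. nrm F (\<lambda>x. f x + g x) \<le> nrm F f + nrm F g)"

text \<open>
  The value 0 off the carrier only serves the locale \<^locale>\<open>Metric_space\<close>, which asks for
  nonnegativity and symmetry of the distance on the whole type.
\<close>

definition fs_dist :: "'d fun_space \<Rightarrow> ('d \<Rightarrow> complex) \<Rightarrow> ('d \<Rightarrow> complex) \<Rightarrow> real" where
  "fs_dist F f g = (if f \<in> elems F \<and> g \<in> elems F then nrm F (\<lambda>x. f x - g x) else 0)"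

lemma Metric_space_fs_dist:
  assumes "normed_fun_space F"
  shows "Metric_space (elems F) (fs_dist F)"
proof -
  have m1: "-1 \<in> scal F"
    using assms unfolding normed_fun_space_def by auto
  have neg: "(\<lambda>x. - f x) \<in> elems F" "nrm F (\<lambda>x. - f x) = nrm F f" if "f \<in> elems F" for f
    using assms m1 that unfolding normed_fun_space_def by fastforce+
  have add: "(\<lambda>x. f x + g x) \<in> elems F" if "f \<in> elems F" "g \<in> elems F" for f g
    using assms that unfolding normed_fun_space_def by simp
  have nrm_add: "nrm F (\<lambda>x. f x + g x) \<le> nrm F f + nrm F g"
    if "f \<in> elems F" "g \<in> elems F" for f g
    using assms that unfolding normed_fun_space_def by simp
  have diff: "(\<lambda>x. f x - g x) \<in> elems F" if "f \<in> elems F" "g \<in> elems F" for f g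
    using add[OF that(1) neg(1)[OF that(2)]] by simp
  have tri: "nrm F (\<lambda>x. f x - h x) \<le> nrm F (\<lambda>x. f x - g x) + nrm F (\<lambda>x. g x - h x)"
    if "f \<in> elems F" "g \<in> elems F" "h \<in> elems F" for f g h
    using nrm_add[OF diff[OF that(1,2)] diff[OF that(2,3)]] by simp
  show ?thesis
  proof
    show "0 \<le> fs_dist F f g" for f g
      using assms diff unfolding fs_dist_def normed_fun_space_def by auto
    show "fs_dist F f g = fs_dist F g f" for f g
      using neg(2)[OF diff, of f g] by (auto simp: fs_dist_def)
    show "fs_dist F f g = 0 \<longleftrightarrow> f = g" if "f \<in> elems F" "g \<in> elems F" for f g
      using assms diff[OF that] that by (auto simp: fs_dist_def normed_fun_space_def fun_eq_iff)
    show "fs_dist F f h \<le> fs_dist F f g + fs_dist F g h"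
      if "f \<in> elems F" "g \<in> elems F" "h \<in> elems F" for f g h
      using tri[OF that] that by (simp add: fs_dist_def)
  qed
qed

abbreviation fs_topology :: "'d fun_space \<Rightarrow> ('d \<Rightarrow> complex) topology" where
  "fs_topology F \<equiv> Metric_space.mtopology (elems F) (fs_dist F)"

text \<open>
  \<open>L\<^sub>2\<close> is represented by square-integrable functions instead of equivalence classes; identities
  between its elements are therefore stated almost everywhere.
\<close>

definition L2 :: "'d fun_space \<Rightarrow> ('d \<Rightarrow> complex) set" where
  "L2 F = {f \<in> borel_measurable (msr F).
     (\<forall>x\<in>dom_of F. f x \<in> scal F) \<and> integrable (msr F) (\<lambda>x. (cmod (f x))\<^sup>2)}"

definition L2_norm :: "'d fun_space \<Rightarrow> ('d \<Rightarrow> complex) \<Rightarrow> real" where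
  "L2_norm F f = sqrt (\<integral>x. (cmod (f x))\<^sup>2 \<partial>msr F)"

text \<open>An embedding is injective: functions in the space that agree almost everywhere are equal.\<close>

definition continuously_embedded_L2 :: "'d fun_space \<Rightarrow> bool" where
  "continuously_embedded_L2 F \<longleftrightarrow>
     elems F \<subseteq> L2 F \<and>
     (\<forall>f\<in>elems F. \<forall>g\<in>elems F. (AE x in msr F. f x = g x) \<longrightarrow> f = g) \<and>
     (\<forall>f\<in>elems F. \<forall>e>0. \<exists>d>0. \<forall>g\<in>elems F.
        nrm F (\<lambda>x. g x - f x) < d \<longrightarrow> L2_norm F (\<lambda>x. g x - f x) < e)"

definition class_A :: "'d fun_space \<Rightarrow> bool" where
  "class_A F \<longleftrightarrow>
     dom_of F \<noteq> {} \<and>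
     normed_fun_space F \<and>
     Metric_space.mcomplete (elems F) (fs_dist F) \<and>
     separable_space (fs_topology F) \<and>
     (\<forall>x\<in>dom_of F. continuous_map (fs_topology F) euclidean (\<lambda>f. f x)) \<and>
     continuously_embedded_L2 F"

definition dual :: "'d fun_space \<Rightarrow> (('d \<Rightarrow> complex) \<Rightarrow> complex) set" where
  "dual F = {N.
     (\<forall>f\<in>elems F. N f \<in> scal F) \<and>
     (\<forall>f\<in>elems F. \<forall>g\<in>elems F. N (\<lambda>x. f x + g x) = N f + N g) \<and>
     (\<forall>c\<in>scal F. \<forall>f\<in>elems F. N (\<lambda>x. c * f x) = c * N f) \<and>
     continuous_map (fs_topology F) euclidean N}"

definition bounded_linear_L2 :: "'d fun_space \<Rightarrow> (('d \<Rightarrow> complex) \<Rightarrow> ('d \<Rightarrow> complex)) \<Rightarrow> bool" where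
  "bounded_linear_L2 F T \<longleftrightarrow>
     (\<forall>f\<in>L2 F. T f \<in> L2 F) \<and>
     (\<forall>f\<in>L2 F. \<forall>g\<in>L2 F. AE x in msr F. T (\<lambda>y. f y + g y) x = T f x + T g x) \<and>
     (\<forall>c\<in>scal F. \<forall>f\<in>L2 F. AE x in msr F. T (\<lambda>y. c * f y) x = c * T f x) \<and>
     (\<exists>C. \<forall>f\<in>L2 F. L2_norm F (T f) \<le> C * L2_norm F f)"

definition rank_le :: "'d fun_space \<Rightarrow> nat \<Rightarrow> (('d \<Rightarrow> complex) \<Rightarrow> ('d \<Rightarrow> complex)) \<Rightarrow> bool" where
  "rank_le F n T \<longleftrightarrow>
     (\<exists>\<psi> \<in> {..<n} \<rightarrow> L2 F. \<forall>f\<in>L2 F. \<exists>c \<in> {..<n} \<rightarrow> scal F.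
        AE x in msr F. T f x = (\<Sum>i<n. c i * \<psi> i x))"

definition worst_case_error :: "'d fun_space \<Rightarrow> (('d \<Rightarrow> complex) \<Rightarrow> ('d \<Rightarrow> complex)) \<Rightarrow> ennreal" where
  "worst_case_error F R = (SUP f \<in> unit_ball F. ennreal (L2_norm F (\<lambda>x. f x - R f x)))"

text \<open>
  Below, indices run through \<open>{..<n}\<close>. A vector of scalars is an element of \<open>{..<n} \<rightarrow>\<^sub>E scal F\<close>;
  the restriction in \<open>\<lambda>i\<in>{..<n}. \<dots>\<close> makes a reconstruction map depend on these \<open>n\<close> numbers only.
\<close>

definition linear_sampling_width :: "'d fun_space \<Rightarrow> nat \<Rightarrow> ennreal" where
  "linear_sampling_width F n =
     (INF (x, \<phi>) \<in> ({..<n} \<rightarrow> dom_of F) \<times> ({..<n} \<rightarrow> L2 F).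
        worst_case_error F (\<lambda>f t. \<Sum>i<n. f (x i) * \<phi> i t))"

definition sampling_width :: "'d fun_space \<Rightarrow> nat \<Rightarrow> ennreal" where
  "sampling_width F n =
     (INF (x, \<phi>) \<in> ({..<n} \<rightarrow> dom_of F) \<times> (({..<n} \<rightarrow>\<^sub>E scal F) \<rightarrow> L2 F).
        worst_case_error F (\<lambda>f. \<phi> (\<lambda>i\<in>{..<n}. f (x i))))"

definition linear_width :: "'d fun_space \<Rightarrow> nat \<Rightarrow> ennreal" where
  "linear_width F n = (INF T \<in> {T. bounded_linear_L2 F T \<and> rank_le F n T}. worst_case_error F T)"

definition gelfand_width :: "'d fun_space \<Rightarrow> nat \<Rightarrow> ennreal" where
  "gelfand_width F n =
     (INF (\<phi>, N) \<in> (({..<n} \<rightarrow>\<^sub>E scal F) \<rightarrow> L2 F) \<times> ({..<n} \<rightarrow> dual F).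
        worst_case_error F (\<lambda>f. \<phi> (\<lambda>i\<in>{..<n}. N i f)))"

definition min_index :: "(nat \<Rightarrow> ennreal) \<Rightarrow> real \<Rightarrow> enat" where
  "min_index w \<epsilon> = Inf (enat ` {n. 1 \<le> n \<and> w n \<le> ennreal \<epsilon>})"

definition n_std :: "real \<Rightarrow> 'd fun_space \<Rightarrow> enat" where
  "n_std \<epsilon> F = min_index (sampling_width F) \<epsilon>"

definition n_std_lin :: "real \<Rightarrow> 'd fun_space \<Rightarrow> enat" where
  "n_std_lin \<epsilon> F = min_index (linear_sampling_width F) \<epsilon>"

definition n_all :: "real \<Rightarrow> 'd fun_space \<Rightarrow> enat" where
  "n_all \<epsilon> F = min_index (gelfand_width F) \<epsilon>"

end

theory Submission
  imports Defs "Jordan_Normal_Form.Determinant"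
begin

text \<open>
  Let \<open>f\<^sub>1, \<dots>, f\<^sub>r\<close> in the unit ball nearly maximise \<open>\<bar>det (N\<^sub>i (f\<^sub>j))\<bar>\<close> for given functionals \<open>N\<^sub>i\<close>, of which
  \<open>r\<close> already determine the common kernel. By Cramer's rule every \<open>f\<close> in the ball differs from a
  combination of the \<open>f\<^sub>j\<close> with coefficients of modulus at most \<open>1 + \<delta>\<close> by an element of that kernel,
  on which the \<open>L\<^sub>2\<close> norm is controlled by the error of any algorithm using \<open>N\<close>. Projecting
  orthogonally onto the span of the \<open>f\<^sub>j\<close> gives \<open>a\<^sub>n \<le> (1 + n) c\<^sub>n\<close>. The hypothesis on \<open>n\<^bsup>all\<^esup>\<close> turns this into
  \<open>a\<^sub>k \<le> (1 + k) exp (1 - (k / A)\<^bsup>1/B\<^esup>)\<close> for \<open>k > A\<close>, and for the chosen \<open>n\<close> this is at most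
  \<open>n\<^sup>2 \<epsilon> / (k (k + 1))\<close> whenever \<open>k \<ge> n\<close>, so that the average of the tail telescopes to \<open>\<epsilon>\<close>.
\<close>

subsection \<open>Square-integrable functions\<close>

text \<open>One complex formula serves both scalar fields: for real-valued functions the value is
  real. On representatives it is only a semi-inner product, whose null vectors are the functions
  vanishing almost everywhere.\<close>

definition L2_inner :: "'d fun_space \<Rightarrow> ('d \<Rightarrow> complex) \<Rightarrow> ('d \<Rightarrow> complex) \<Rightarrow> complex" where
  "L2_inner F f g = (\<integral>x. f x * cnj (g x) \<partial>msr F)"

lemma norm_add_square_le:
  fixes a b :: "'a :: real_normed_vector"
  shows "(norm (a + b))\<^sup>2 \<le> 2 * (norm a)\<^sup>2 + 2 * (norm b)\<^sup>2"
proof -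
  have "(norm (a + b))\<^sup>2 \<le> (norm a + norm b)\<^sup>2"
    by (intro power_mono norm_triangle_ineq) auto
  also have "\<dots> \<le> 2 * (norm a)\<^sup>2 + 2 * (norm b)\<^sup>2"
    using sum_squares_bound[of "norm a" "norm b"] by (simp add: power2_sum)
  finally show ?thesis .
qed

locale scalar_field =
  fixes F :: "'d fun_space"
  assumes scal: "scal F = \<real> \<or> scal F = UNIV"
begin

lemma scal_closed [simp, intro]:
  "0 \<in> scal F" "1 \<in> scal F" "complex_of_real r \<in> scal F"
  "a \<in> scal F \<Longrightarrow> - a \<in> scal F"
  "a \<in> scal F \<Longrightarrow> b \<in> scal F \<Longrightarrow> a + b \<in> scal F"
  "a \<in> scal F \<Longrightarrow> b \<in> scal F \<Longrightarrow> a - b \<in> scal F"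
  "a \<in> scal F \<Longrightarrow> b \<in> scal F \<Longrightarrow> a * b \<in> scal F"
  "a \<in> scal F \<Longrightarrow> b \<in> scal F \<Longrightarrow> a / b \<in> scal F"
  using scal by (elim disjE; simp)+

lemma scal_sum: "(\<And>i. i \<in> I \<Longrightarrow> a i \<in> scal F) \<Longrightarrow> (\<Sum>i\<in>I. a i) \<in> scal F"
  by (induction I rule: infinite_finite_induct) auto

lemma scal_prod: "(\<And>i. i \<in> I \<Longrightarrow> a i \<in> scal F) \<Longrightarrow> (\<Prod>i\<in>I. a i) \<in> scal F"
  by (induction I rule: infinite_finite_induct) auto

lemma L2_measurable: "f \<in> L2 F \<Longrightarrow> f \<in> borel_measurable (msr F)"
  and L2_square_integrable: "f \<in> L2 F \<Longrightarrow> integrable (msr F) (\<lambda>x. (cmod (f x))\<^sup>2)"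
  and L2_scal: "f \<in> L2 F \<Longrightarrow> x \<in> dom_of F \<Longrightarrow> f x \<in> scal F"
  by (auto simp: L2_def)

lemma L2_zero [simp, intro]: "(\<lambda>_. 0) \<in> L2 F"
  by (simp add: L2_def)

lemma L2_add [intro]:
  assumes "f \<in> L2 F" "g \<in> L2 F"
  shows "(\<lambda>x. f x + g x) \<in> L2 F"
proof -
  note [measurable] = assms[THEN L2_measurable]
  have "integrable (msr F) (\<lambda>x. (cmod (f x + g x))\<^sup>2)"
  proof (rule Bochner_Integration.integrable_bound)
    show "integrable (msr F) (\<lambda>x. 2 * (cmod (f x))\<^sup>2 + 2 * (cmod (g x))\<^sup>2)"
      using assms[THEN L2_square_integrable]
      by (intro Bochner_Integration.integrable_add integrable_mult_right)
    show "AE x in msr F. norm ((cmod (f x + g x))\<^sup>2)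
        \<le> norm (2 * (cmod (f x))\<^sup>2 + 2 * (cmod (g x))\<^sup>2)"
      using norm_add_square_le by (intro AE_I2) simp
  qed measurable
  then show ?thesis
    using assms by (auto simp: L2_def)
qed

lemma L2_scale [intro]:
  assumes "c \<in> scal F" "f \<in> L2 F"
  shows "(\<lambda>x. c * f x) \<in> L2 F"
  using assms by (auto simp: L2_def norm_mult power_mult_distrib)

lemma L2_diff [intro]:
  assumes "f \<in> L2 F" "g \<in> L2 F"
  shows "(\<lambda>x. f x - g x) \<in> L2 F"
  using L2_add[OF assms(1) L2_scale[OF _ assms(2), of "-1"]] by simp

lemma L2_sum:
  assumes "finite I" "\<And>i. i \<in> I \<Longrightarrow> f i \<in> L2 F"
  shows "(\<lambda>x. \<Sum>i\<in>I. f i x) \<in> L2 F"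
  using assms by (induction rule: finite_induct) auto

lemma L2_lincomb:
  assumes "finite I" "\<And>i. i \<in> I \<Longrightarrow> c i \<in> scal F" "\<And>i. i \<in> I \<Longrightarrow> f i \<in> L2 F"
  shows "(\<lambda>x. \<Sum>i\<in>I. c i * f i x) \<in> L2 F"
  using assms by (intro L2_sum) auto

section \<open>Inner product and norm of square-integrable functions\<close>

lemma L2_inner_integrable:
  assumes "f \<in> L2 F" "g \<in> L2 F"
  shows "integrable (msr F) (\<lambda>x. f x * cnj (g x))"
proof -
  note [measurable] = assms[THEN L2_measurable]
  show ?thesis
  proof (rule Bochner_Integration.integrable_bound)
    show "integrable (msr F) (\<lambda>x. (cmod (f x))\<^sup>2 + (cmod (g x))\<^sup>2)"
      using assms[THEN L2_square_integrable] by (intro Bochner_Integration.integrable_add)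
    have "cmod (f x) * cmod (g x) \<le> (cmod (f x))\<^sup>2 + (cmod (g x))\<^sup>2" for x
      using sum_squares_bound[of "cmod (f x)" "cmod (g x)"]
        mult_nonneg_nonneg[OF norm_ge_zero norm_ge_zero, of "f x" "g x"]
      by (simp only: mult.assoc)
    then show "AE x in msr F. norm (f x * cnj (g x)) \<le> norm ((cmod (f x))\<^sup>2 + (cmod (g x))\<^sup>2)"
      by (intro AE_I2) (simp add: norm_mult)
    show "(\<lambda>x. f x * cnj (g x)) \<in> borel_measurable (msr F)"
      by (intro borel_measurable_times borel_measurable_continuous_on[where f = cnj]
          continuous_intros) measurable
  qed
qed

text \<open>In the real case the integral equals its own conjugate. This keeps projection
  coefficients inside the scalar field.\<close>

lemma L2_inner_scal:
  assumes "f \<in> L2 F" "g \<in> L2 F"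
  shows "L2_inner F f g \<in> scal F"
proof (cases "scal F = UNIV")
  case False
  then have R: "scal F = \<real>" using scal by simp
  have "cnj (L2_inner F f g) = (\<integral>x. cnj (f x * cnj (g x)) \<partial>msr F)"
    unfolding L2_inner_def by (rule Bochner_Integration.integral_cnj[symmetric])
  also have "\<dots> = L2_inner F f g"
    unfolding L2_inner_def
    using L2_scal[OF assms(1)] L2_scal[OF assms(2)]
    by (intro Bochner_Integration.integral_cong) (auto simp: R Reals_cnj_iff)
  finally show ?thesis by (simp add: R Reals_cnj_iff)
qed auto

lemma L2_inner_add_left:
  "f \<in> L2 F \<Longrightarrow> g \<in> L2 F \<Longrightarrow> h \<in> L2 F \<Longrightarrow>
    L2_inner F (\<lambda>x. f x + g x) h = L2_inner F f h + L2_inner F g h"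
  using L2_inner_integrable[of f h] L2_inner_integrable[of g h]
  by (simp add: L2_inner_def distrib_right)

lemma L2_inner_scale_left: "L2_inner F (\<lambda>x. c * f x) h = c * L2_inner F f h"
  by (simp add: L2_inner_def mult.assoc)

lemma L2_inner_diff_left:
  "f \<in> L2 F \<Longrightarrow> g \<in> L2 F \<Longrightarrow> h \<in> L2 F \<Longrightarrow>
    L2_inner F (\<lambda>x. f x - g x) h = L2_inner F f h - L2_inner F g h"
  using L2_inner_integrable[of f h] L2_inner_integrable[of g h]
  by (simp add: L2_inner_def left_diff_distrib)

lemma L2_inner_cnj: "L2_inner F g f = cnj (L2_inner F f g)"
  by (simp add: L2_inner_def mult.commute flip: Bochner_Integration.integral_cnj)

lemma L2_inner_lincomb_right:
  assumes "finite I" "\<And>i. i \<in> I \<Longrightarrow> c i \<in> scal F" "\<And>i. i \<in> I \<Longrightarrow> f i \<in> L2 F" "g \<in> L2 F"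
    and "\<And>i. i \<in> I \<Longrightarrow> L2_inner F g (f i) = 0"
  shows "L2_inner F g (\<lambda>x. \<Sum>i\<in>I. c i * f i x) = 0"
  using assms
proof (induction rule: finite_induct)
  case empty
  show ?case by (simp add: L2_inner_def)
next
  case (insert j I)
  have "L2_inner F (\<lambda>x. c j * f j x + (\<Sum>i\<in>I. c i * f i x)) g
      = c j * L2_inner F (f j) g + L2_inner F (\<lambda>x. \<Sum>i\<in>I. c i * f i x) g"
    using insert by (subst L2_inner_add_left) (auto simp: L2_inner_scale_left intro: L2_lincomb)
  also have "\<dots> = 0"
    using insert by (simp add: L2_inner_cnj[of _ g])
  finally show ?case
    using insert by (simp add: L2_inner_cnj[of g])
qed

lemma L2_norm_nonneg [simp]: "0 \<le> L2_norm F f"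
  by (simp add: L2_norm_def)

lemma L2_norm_power2: "(L2_norm F f)\<^sup>2 = (\<integral>x. (cmod (f x))\<^sup>2 \<partial>msr F)"
  by (simp add: L2_norm_def)

lemma L2_norm_scale: "L2_norm F (\<lambda>x. c * f x) = cmod c * L2_norm F f"
  by (simp add: L2_norm_def norm_mult power_mult_distrib real_sqrt_mult)

lemma L2_inner_self: "L2_inner F f f = complex_of_real ((L2_norm F f)\<^sup>2)"
  by (simp add: L2_inner_def L2_norm_power2 complex_norm_square[symmetric] flip: integral_complex_of_real)

text \<open>A null vector vanishes almost everywhere, so every product against it integrates to 0.
  Hence the quotient by \<open>L2_inner F r r\<close> in the orthogonalisation below is still right
  when division by 0 returns 0.\<close>

lemma L2_inner_null:
  assumes "f \<in> L2 F" "g \<in> L2 F" "L2_inner F g g = 0"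
  shows "L2_inner F f g = 0"
proof -
  have "(\<integral>x. (cmod (g x))\<^sup>2 \<partial>msr F) = 0"
    using assms(3) by (simp add: L2_inner_self flip: L2_norm_power2)
  then have "AE x in msr F. (cmod (g x))\<^sup>2 = 0"
    using L2_square_integrable[OF assms(2)] by (subst (asm) integral_nonneg_eq_0_iff_AE) auto
  then have "L2_inner F f g = (\<integral>x. 0 \<partial>msr F)"
    unfolding L2_inner_def
    using borel_measurable_integrable[OF L2_inner_integrable[OF assms(1,2)]]
    by (intro integral_cong_AE) auto
  then show ?thesis by simp
qed

lemma L2_norm_pythagoras:
  assumes "f \<in> L2 F" "g \<in> L2 F" "L2_inner F f g = 0"
  shows "(L2_norm F (\<lambda>x. f x + g x))\<^sup>2 = (L2_norm F f)\<^sup>2 + (L2_norm F g)\<^sup>2"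
proof -
  have fg: "(\<lambda>x. f x + g x) \<in> L2 F" using assms by auto
  have right: "L2_inner F h (\<lambda>x. f x + g x) = L2_inner F h f + L2_inner F h g"
    if "h \<in> L2 F" for h
    using L2_inner_add_left[OF assms(1,2) that] by (metis L2_inner_cnj complex_cnj_add)
  have "L2_inner F (\<lambda>x. f x + g x) (\<lambda>x. f x + g x)
      = L2_inner F f (\<lambda>x. f x + g x) + L2_inner F g (\<lambda>x. f x + g x)"
    using assms fg by (intro L2_inner_add_left) auto
  also have "\<dots> = L2_inner F f f + L2_inner F g g"
    using assms by (simp add: right L2_inner_cnj[of g f])
  finally show ?thesis
    by (simp only: L2_inner_self flip: of_real_add) (simp only: of_real_eq_iff)
qed

text \<open>The pointwise bound \<open>2 * a^2 + 2 * b^2\<close> for the square loses nothing here,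
  since both norms share the bound \<open>c\<close> and
  \<open>2 * c^2 + 2 * c^2 = (2 * c)^2\<close>.\<close>

lemma L2_norm_diff_le:
  assumes "f \<in> L2 F" "g \<in> L2 F" "L2_norm F f \<le> c" "L2_norm F g \<le> c"
  shows "L2_norm F (\<lambda>x. f x - g x) \<le> 2 * c"
proof -
  have "(L2_norm F (\<lambda>x. f x - g x))\<^sup>2
      \<le> (\<integral>x. 2 * (cmod (f x))\<^sup>2 + 2 * (cmod (g x))\<^sup>2 \<partial>msr F)"
    unfolding L2_norm_power2
  proof (rule integral_mono)
    show "(cmod (f x - g x))\<^sup>2 \<le> 2 * (cmod (f x))\<^sup>2 + 2 * (cmod (g x))\<^sup>2" for x
      using norm_add_square_le[of "f x" "- g x"] by simp
    show "integrable (msr F) (\<lambda>x. 2 * (cmod (f x))\<^sup>2 + 2 * (cmod (g x))\<^sup>2)"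
      using assms(1,2)[THEN L2_square_integrable]
      by (intro Bochner_Integration.integrable_add integrable_mult_right)
  qed (intro L2_square_integrable L2_diff assms(1,2))
  also have "\<dots> = 2 * (L2_norm F f)\<^sup>2 + 2 * (L2_norm F g)\<^sup>2"
    unfolding L2_norm_power2 using assms L2_square_integrable by simp
  also have "\<dots> \<le> 2 * c\<^sup>2 + 2 * c\<^sup>2"
    using assms by (intro add_mono mult_left_mono power_mono) auto
  also have "\<dots> = (2 * c)\<^sup>2" by (simp add: power2_eq_square)
  finally show ?thesis
  proof (rule power2_le_imp_le)
    show "0 \<le> 2 * c" using assms(3) L2_norm_nonneg[of f] by linarith
  qed
qed

text \<open>Induction on the number of functions: the coefficient of the new function is read off
  its residual against the previous ones, so linear dependence only costs a division by 0.\<close>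

lemma normal_equations_solvable:
  fixes m :: nat
  assumes f: "f \<in> {..<m} \<rightarrow> L2 F"
  shows "\<exists>\<alpha>. (\<forall>g\<in>L2 F. \<forall>j<m. \<alpha> j g \<in> scal F) \<and>
    (\<forall>g\<in>L2 F. \<forall>h\<in>L2 F. \<forall>j<m. \<alpha> j (\<lambda>x. g x + h x) = \<alpha> j g + \<alpha> j h) \<and>
    (\<forall>c\<in>scal F. \<forall>g\<in>L2 F. \<forall>j<m. \<alpha> j (\<lambda>x. c * g x) = c * \<alpha> j g) \<and>
    (\<forall>g\<in>L2 F. \<forall>k<m. L2_inner F (\<lambda>x. g x - (\<Sum>j<m. \<alpha> j g * f j x)) (f k) = 0)"
  using f
proof (induction m)
  case 0
  show ?case by simp
next
  case (Suc m)
  have "f \<in> {..<m} \<rightarrow> L2 F" using Suc.prems by auto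
  from Suc.IH[OF this] obtain \<alpha> where \<alpha>: "\<forall>g\<in>L2 F. \<forall>j<m. \<alpha> j g \<in> scal F"
    "\<forall>g\<in>L2 F. \<forall>h\<in>L2 F. \<forall>j<m. \<alpha> j (\<lambda>x. g x + h x) = \<alpha> j g + \<alpha> j h"
    "\<forall>c\<in>scal F. \<forall>g\<in>L2 F. \<forall>j<m. \<alpha> j (\<lambda>x. c * g x) = c * \<alpha> j g"
    "\<forall>g\<in>L2 F. \<forall>k<m. L2_inner F (\<lambda>x. g x - (\<Sum>j<m. \<alpha> j g * f j x)) (f k) = 0"
    by blast
  note scal_\<alpha> = \<alpha>(1)[rule_format] and add_\<alpha> = \<alpha>(2)[rule_format]
    and scale_\<alpha> = \<alpha>(3)[rule_format] and orth_\<alpha> = \<alpha>(4)[rule_format]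
  have f: "f j \<in> L2 F" if "j < Suc m" for j using Suc.prems that by auto
  define T where "T g x = (\<Sum>j<m. \<alpha> j g * f j x)" for g x
  have T: "T g \<in> L2 F" if "g \<in> L2 F" for g
    unfolding T_def using that f scal_\<alpha> by (intro L2_lincomb) auto
  have orth_lincomb: "L2_inner F h (T g) = 0"
    if "h \<in> L2 F" "g \<in> L2 F" "\<And>k. k < m \<Longrightarrow> L2_inner F h (f k) = 0" for g h
    unfolding T_def using that f scal_\<alpha> by (intro L2_inner_lincomb_right) auto
  \<comment> \<open>One Gram-Schmidt step: the part of the new function orthogonal to all previous
    ones.\<close>
  define r where "r x = f m x - T (f m) x" for x
  have r: "r \<in> L2 F" unfolding r_def using T f by auto
  have r_orth: "L2_inner F r (f k) = 0" if "k < m" for k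
    using orth_\<alpha>[OF f[of m] that] by (simp add: r_def[abs_def] T_def)
  define c where "c g = L2_inner F g r / L2_inner F r r" for g
  have c: "c g \<in> scal F" if "g \<in> L2 F" for g
    unfolding c_def using that r L2_inner_scal by auto
  \<comment> \<open>Adding \<open>c g * r\<close> to the old projection and expanding
    \<open>r\<close> in the original functions subtracts \<open>c g * \<alpha> j (f m)\<close> from
    each old coefficient.\<close>
  define \<beta> where "\<beta> j g = (if j = m then c g else \<alpha> j g - c g * \<alpha> j (f m))" for j g
  have sum_\<beta>: "(\<Sum>j<Suc m. \<beta> j g * f j x) = T g x + c g * r x" for g x
    by (simp add: \<beta>_def r_def T_def algebra_simps sum_subtractf sum_distrib_left)
  have orth_\<beta>: "L2_inner F (\<lambda>x. g x - (\<Sum>j<Suc m. \<beta> j g * f j x)) (f k) = 0"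
    if g: "g \<in> L2 F" and k: "k < Suc m" for g k
  proof -
    define h where "h x = (g x - T g x) - c g * r x" for x
    have gT: "(\<lambda>x. g x - T g x) \<in> L2 F" using g T by auto
    have cr: "(\<lambda>x. c g * r x) \<in> L2 F" using c g r by auto
    have h: "h \<in> L2 F" unfolding h_def using gT cr by auto
    have inner_h: "L2_inner F h z = L2_inner F (\<lambda>x. g x - T g x) z - c g * L2_inner F r z"
      if "z \<in> L2 F" for z
      unfolding h_def using gT cr that by (subst L2_inner_diff_left) (auto simp: L2_inner_scale_left)
    have h_orth: "L2_inner F h (f k) = 0" if "k < m" for k
      using inner_h[of "f k"] f[of k] orth_\<alpha>[OF g that] r_orth[OF that] that by (simp add: T_def)
    have "L2_inner F h r = 0"
    proof -
      have "L2_inner F (T g) r = 0"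
        using orth_lincomb[OF r g r_orth] L2_inner_cnj[of "T g" r] by simp
      then have "L2_inner F h r = L2_inner F g r - c g * L2_inner F r r"
        using inner_h[OF r] g T r by (simp add: L2_inner_diff_left)
      then show ?thesis
        using L2_inner_null[OF g r] by (simp add: c_def)
    qed
    \<comment> \<open>Orthogonality to \<open>f m\<close> comes from its splitting into
      \<open>r\<close> and \<open>T (f m)\<close>, both orthogonal to \<open>h\<close>.\<close>
    moreover have "L2_inner F h (T (f m)) = 0"
      using orth_lincomb[OF h f[of m] h_orth] by simp
    moreover have "L2_inner F (f m) h = L2_inner F (\<lambda>x. r x + T (f m) x) h"
      by (simp add: r_def)
    ultimately have "L2_inner F h (f m) = 0"
      using L2_inner_add_left[OF r T[OF f[of m]] h] L2_inner_cnj[of h] by simp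
    then have "L2_inner F h (f k) = 0" using h_orth k by (auto simp: less_Suc_eq)
    then show ?thesis unfolding h_def sum_\<beta> by (simp add: algebra_simps)
  qed
  have scal_\<beta>: "\<beta> j g \<in> scal F" if "g \<in> L2 F" "j < Suc m" for g j
    unfolding \<beta>_def using that(2) c[OF that(1)] scal_\<alpha>[OF that(1), of j] scal_\<alpha>[OF f[of m], of j]
    by (auto simp: less_Suc_eq)
  have add_\<beta>: "\<beta> j (\<lambda>x. g x + h x) = \<beta> j g + \<beta> j h"
    if "g \<in> L2 F" "h \<in> L2 F" "j < Suc m" for g h j
    using that add_\<alpha>[OF that(1,2), of j] L2_inner_add_left[OF that(1,2) r]
    by (auto simp: \<beta>_def c_def add_divide_distrib distrib_right less_Suc_eq)
  have scale_\<beta>: "\<beta> j (\<lambda>x. a * g x) = a * \<beta> j g"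
    if "a \<in> scal F" "g \<in> L2 F" "j < Suc m" for a g j
    using that scale_\<alpha>[OF that(1,2), of j]
    by (auto simp: \<beta>_def c_def L2_inner_scale_left right_diff_distrib less_Suc_eq)
  show ?case
    by (intro exI[of _ \<beta>] conjI ballI allI impI scal_\<beta> add_\<beta> scale_\<beta> orth_\<beta>; assumption)
qed

text \<open>The operator is the orthogonal projection onto the span of the given functions. Its
  residual is orthogonal to that span, so Pythagoras compares it with any other combination.\<close>

lemma best_approximation_operator:
  fixes m :: nat
  assumes f: "f \<in> {..<m} \<rightarrow> L2 F"
  obtains T where "bounded_linear_L2 F T" "rank_le F m T"
    "\<And>g c. g \<in> L2 F \<Longrightarrow> c \<in> {..<m} \<rightarrow> scal F \<Longrightarrow>
      L2_norm F (\<lambda>x. g x - T g x) \<le> L2_norm F (\<lambda>x. g x - (\<Sum>j<m. c j * f j x))"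
proof -
  obtain \<alpha> where \<alpha>: "\<forall>g\<in>L2 F. \<forall>j<m. \<alpha> j g \<in> scal F"
    "\<forall>g\<in>L2 F. \<forall>h\<in>L2 F. \<forall>j<m. \<alpha> j (\<lambda>x. g x + h x) = \<alpha> j g + \<alpha> j h"
    "\<forall>c\<in>scal F. \<forall>g\<in>L2 F. \<forall>j<m. \<alpha> j (\<lambda>x. c * g x) = c * \<alpha> j g"
    "\<forall>g\<in>L2 F. \<forall>k<m. L2_inner F (\<lambda>x. g x - (\<Sum>j<m. \<alpha> j g * f j x)) (f k) = 0"
    using normal_equations_solvable[OF f] by (elim exE conjE) (rule that)
  note scal_\<alpha> = \<alpha>(1)[rule_format] and add_\<alpha> = \<alpha>(2)[rule_format]
    and scale_\<alpha> = \<alpha>(3)[rule_format] and orth_\<alpha> = \<alpha>(4)[rule_format]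
  define T where "T g x = (\<Sum>j<m. \<alpha> j g * f j x)" for g x
  have T: "T g \<in> L2 F" if "g \<in> L2 F" for g
    unfolding T_def using that f scal_\<alpha> by (intro L2_lincomb) auto
  have gT: "(\<lambda>x. g x - T g x) \<in> L2 F" if "g \<in> L2 F" for g
    using that T by auto
  have pyth: "(L2_norm F (\<lambda>x. g x - (\<Sum>j<m. c j * f j x)))\<^sup>2
      = (L2_norm F (\<lambda>x. g x - T g x))\<^sup>2 + (L2_norm F (\<lambda>x. T g x - (\<Sum>j<m. c j * f j x)))\<^sup>2"
    if g: "g \<in> L2 F" and c: "c \<in> {..<m} \<rightarrow> scal F" for g c
  proof -
    define d where "d x = (\<Sum>j<m. (\<alpha> j g - c j) * f j x)" for x
    have d: "d x = T g x - (\<Sum>j<m. c j * f j x)" for x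
      by (simp add: d_def T_def sum_subtractf left_diff_distrib)
    have "L2_inner F (\<lambda>x. g x - T g x) d = 0"
      unfolding d_def
    proof (rule L2_inner_lincomb_right)
      show "L2_inner F (\<lambda>x. g x - T g x) (f j) = 0" if "j \<in> {..<m}" for j
        using orth_\<alpha>[OF g] that by (simp add: T_def)
    qed (use gT[OF g] f c scal_\<alpha>[OF g] in auto)
    moreover have "d \<in> L2 F"
      unfolding d_def using f c scal_\<alpha>[OF g] by (intro L2_lincomb) auto
    ultimately have "(L2_norm F (\<lambda>x. (g x - T g x) + d x))\<^sup>2
        = (L2_norm F (\<lambda>x. g x - T g x))\<^sup>2 + (L2_norm F d)\<^sup>2"
      by (intro L2_norm_pythagoras gT[OF g])
    then show ?thesis by (simp add: d[abs_def])
  qed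
  show thesis
  proof (rule that[of T])
    have "L2_norm F (T g) \<le> 1 * L2_norm F g" if "g \<in> L2 F" for g
    proof -
      \<comment> \<open>Pythagoras with all coefficients 0 shows that \<open>T\<close> is a
        contraction.\<close>
      have "(L2_norm F g)\<^sup>2 = (L2_norm F (\<lambda>x. g x - T g x))\<^sup>2 + (L2_norm F (T g))\<^sup>2"
        using pyth[OF that, of "\<lambda>_. 0"] by simp
      then have "(L2_norm F (T g))\<^sup>2 \<le> (L2_norm F g)\<^sup>2" by simp
      then show ?thesis using power2_le_imp_le[OF _ L2_norm_nonneg] by simp
    qed
    moreover have "T (\<lambda>y. g y + h y) x = T g x + T h x" if "g \<in> L2 F" "h \<in> L2 F" for g h x
      using that by (simp add: T_def add_\<alpha> distrib_right sum.distrib)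
    moreover have "T (\<lambda>y. c * g y) x = c * T g x" if "g \<in> L2 F" "c \<in> scal F" for g c x
      using that by (simp add: T_def scale_\<alpha> sum_distrib_left mult.assoc)
    ultimately show "bounded_linear_L2 F T"
      unfolding bounded_linear_L2_def using T by (intro conjI exI[of _ 1]) auto
    show "rank_le F m T"
      unfolding rank_le_def
    proof (intro bexI[of _ f] ballI)
      fix g assume "g \<in> L2 F"
      then have "(\<lambda>j. \<alpha> j g) \<in> {..<m} \<rightarrow> scal F" using scal_\<alpha> by simp
      moreover have "AE x in msr F. T g x = (\<Sum>j<m. \<alpha> j g * f j x)" by (simp add: T_def)
      ultimately show "\<exists>c\<in>{..<m} \<rightarrow> scal F. AE x in msr F. T g x = (\<Sum>j<m. c j * f j x)"
        by (intro bexI[where x = "\<lambda>j. \<alpha> j g"])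
    qed (fact f)
    show "L2_norm F (\<lambda>x. g x - T g x) \<le> L2_norm F (\<lambda>x. g x - (\<Sum>j<m. c j * f j x))"
      if "g \<in> L2 F" "c \<in> {..<m} \<rightarrow> scal F" for g c
    proof (rule power2_le_imp_le[OF _ L2_norm_nonneg])
      show "(L2_norm F (\<lambda>x. g x - T g x))\<^sup>2
          \<le> (L2_norm F (\<lambda>x. g x - (\<Sum>j<m. c j * f j x)))\<^sup>2"
        by (subst pyth[OF that]) simp_all
    qed
  qed
qed

section \<open>Elementary comparisons between widths\<close>

lemma rank_le_mono:
  assumes "rank_le F m T" "m \<le> n"
  shows "rank_le F n T"
proof -
  obtain \<psi> where \<psi>: "\<psi> \<in> {..<m} \<rightarrow> L2 F"
    and rep: "\<And>f. f \<in> L2 F \<Longrightarrow> \<exists>c \<in> {..<m} \<rightarrow> scal F. AE x in msr F. T f x = (\<Sum>i<m. c i * \<psi> i x)"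
    using assms(1) unfolding rank_le_def by blast
  define \<psi>' where "\<psi>' i = (if i < m then \<psi> i else (\<lambda>_. 0))" for i
  show ?thesis
    unfolding rank_le_def
  proof (intro bexI[of _ \<psi>'] ballI)
    fix f assume "f \<in> L2 F"
    then obtain c where c: "c \<in> {..<m} \<rightarrow> scal F" "AE x in msr F. T f x = (\<Sum>i<m. c i * \<psi> i x)"
      using rep by blast
    define c' where "c' i = (if i < m then c i else 0)" for i
    have "(\<Sum>i<n. c' i * \<psi>' i x) = (\<Sum>i<m. c i * \<psi> i x)" for x
      using assms(2) by (intro sum.mono_neutral_cong_right) (auto simp: c'_def \<psi>'_def)
    then show "\<exists>c\<in>{..<n} \<rightarrow> scal F. AE x in msr F. T f x = (\<Sum>i<n. c i * \<psi>' i x)"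
      using c by (intro bexI[of _ c']) (auto simp: c'_def Pi_iff)
  qed (use \<psi> in \<open>auto simp: \<psi>'_def Pi_iff\<close>)
qed

lemma linear_width_antimono: "m \<le> n \<Longrightarrow> linear_width F n \<le> linear_width F m"
  unfolding linear_width_def by (intro INF_superset_mono) (auto intro: rank_le_mono)

text \<open>A linear combination with fixed functions is one admissible reconstruction map, and it
  depends only on the \<open>n\<close> sampled values.\<close>

lemma sampling_width_le_linear_sampling_width:
  "sampling_width F n \<le> linear_sampling_width F n"
  unfolding linear_sampling_width_def
proof (intro INF_greatest, clarify)
  fix x \<phi> assume x: "x \<in> {..<n} \<rightarrow> dom_of F" and \<phi>: "\<phi> \<in> {..<n} \<rightarrow> L2 F"
  define \<Phi> where "\<Phi> v t = (\<Sum>i<n. v i * \<phi> i t)" for v :: "nat \<Rightarrow> complex" and t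
  have "\<Phi> \<in> ({..<n} \<rightarrow>\<^sub>E scal F) \<rightarrow> L2 F"
    unfolding \<Phi>_def using \<phi> by (auto intro!: L2_lincomb simp: PiE_iff)
  moreover have "\<Phi> (\<lambda>i\<in>{..<n}. f (x i)) = (\<lambda>t. \<Sum>i<n. f (x i) * \<phi> i t)" for f
    by (simp add: \<Phi>_def fun_eq_iff)
  ultimately show "sampling_width F n \<le> worst_case_error F (\<lambda>f t. \<Sum>i<n. f (x i) * \<phi> i t)"
    unfolding sampling_width_def using x by (intro INF_lower2[of "(x, \<Phi>)"]) auto
qed

end

subsection \<open>Determinants and approximate Auerbach systems\<close>

text \<open>Entries are a function of two indices, so that replacing a column is a case distinction
  or a function update; only indices below \<open>r\<close> matter.\<close>

definition square_det :: "nat \<Rightarrow> (nat \<Rightarrow> nat \<Rightarrow> complex) \<Rightarrow> complex" where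
  "square_det r M = Determinant.det (Matrix.mat r r (\<lambda>(i, j). M i j))"

lemma square_det_leibniz:
  "square_det r M = (\<Sum>p | p permutes {0..<r}. signof p * (\<Prod>i=0..<r. M i (p i)))"
  unfolding square_det_def Determinant.det_def
  by (auto intro!: sum.cong prod.cong simp: permutes_in_image)

lemma square_det_cong:
  assumes "\<And>i j. i < r \<Longrightarrow> j < r \<Longrightarrow> M i j = M' i j"
  shows "square_det r M = square_det r M'"
  unfolding square_det_def using assms by (intro arg_cong[where f = Determinant.det] eq_matI) auto

text \<open>The Leibniz sum has \<open>fact r\<close> terms of modulus at most \<open>K ^ r\<close>.
  It serves to make the supremum of determinants over the unit ball finite.\<close>

lemma square_det_bound:
  assumes "\<And>i j. i < r \<Longrightarrow> j < r \<Longrightarrow> cmod (M i j) \<le> K"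
  shows "cmod (square_det r M) \<le> fact r * K ^ r"
proof -
  have "cmod (signof p * (\<Prod>i=0..<r. M i (p i))) \<le> K ^ r" if p: "p permutes {0..<r}" for p
  proof -
    have "(\<Prod>i=0..<r. cmod (M i (p i))) \<le> (\<Prod>i=0..<r. K)"
      using assms permutes_in_image[OF p] by (intro prod_mono) auto
    then show ?thesis by (simp add: norm_mult prod_norm sign_def)
  qed
  then have "cmod (square_det r M) \<le> (\<Sum>p | p permutes {0..<r}. K ^ r)"
    unfolding square_det_leibniz by (intro sum_norm_le) auto
  then show ?thesis by (simp add: card_permutations[of _ r])
qed

lemma square_det_diagonal_nonzero:
  assumes "\<And>i j. i < r \<Longrightarrow> j < r \<Longrightarrow> i \<noteq> j \<Longrightarrow> M i j = 0" "\<And>i. i < r \<Longrightarrow> M i i \<noteq> 0"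
  shows "square_det r M \<noteq> 0"
proof -
  have "square_det r M = prod_list (diag_mat (Matrix.mat r r (\<lambda>(i, j). M i j)))"
    unfolding square_det_def using assms by (intro det_upper_triangular[of _ r]) auto
  then show ?thesis
    using assms(2) by (auto simp: prod_list_zero_iff diag_mat_def)
qed

text \<open>Invertibility gives a solution of the linear system with right-hand side
  \<open>v\<close>; Cramer's lemma identifies its entries as the quotients in which \<open>v\<close>
  replaces column \<open>j\<close>.\<close>

lemma cramer_rule:
  assumes "square_det r M \<noteq> 0" "i < r"
  shows "(\<Sum>j<r. square_det r (\<lambda>i k. if k = j then v i else M i k) / square_det r M * M i j) = v i"
proof -
  define A where "A = Matrix.mat r r (\<lambda>(i, j). M i j)"
  have A: "A \<in> carrier_mat r r" by (simp add: A_def)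
  have dA: "Determinant.det A = square_det r M" by (simp add: A_def square_det_def)
  then obtain B where B: "B \<in> carrier_mat r r" "A * B = 1\<^sub>m r"
    using det_non_zero_imp_unit[OF A] assms(1) by (auto simp: Units_def ring_mat_def)
  define x where "x = B *\<^sub>v Matrix.vec r v"
  have x: "x \<in> carrier_vec r" using B by (simp add: x_def)
  have Ax: "A *\<^sub>v x = Matrix.vec r v"
    using A B by (simp add: x_def assoc_mult_mat_vec[symmetric, of _ r r _ r])
  have xj: "vec_index x j = square_det r (\<lambda>i k. if k = j then v i else M i k) / square_det r M"
    if "j < r" for j
  proof -
    have "replace_col A (Matrix.vec r v) j
        = Matrix.mat r r (\<lambda>(i, k). if k = j then v i else M i k)"
      by (intro eq_matI) (auto simp: replace_col_def A_def)
    then show ?thesis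
      using cramer_lemma_mat[OF A x that] assms(1) dA
      unfolding Ax by (simp add: square_det_def field_simps)
  qed
  have "v i = vec_index (A *\<^sub>v x) i" using assms(2) by (simp add: Ax)
  also have "\<dots> = (\<Sum>j<r. M i j * vec_index x j)"
    using assms(2) x by (simp add: A_def scalar_prod_def lessThan_atLeast0)
  finally show ?thesis by (simp add: xj mult.commute)
qed

context scalar_field
begin

lemma square_det_scal:
  assumes "\<And>i j. i < r \<Longrightarrow> j < r \<Longrightarrow> M i j \<in> scal F"
  shows "square_det r M \<in> scal F"
proof -
  have "signof p * (\<Prod>i=0..<r. M i (p i)) \<in> scal F" if "p permutes {0..<r}" for p
    using assms permutes_in_image[OF that]
    by (intro scal_closed(7) scal_prod) (auto simp: sign_def)
  then show ?thesis unfolding square_det_leibniz by (intro scal_sum) auto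
qed

end

section \<open>Normed function spaces and their continuous functionals\<close>

locale normed_function_space =
  fixes F :: "'d fun_space"
  assumes normed: "normed_fun_space F"
begin

sublocale scalar_field F
  using normed by unfold_locales (simp add: normed_fun_space_def)

lemma elems_zero [simp, intro]: "(\<lambda>_. 0) \<in> elems F"
  and elems_add: "f \<in> elems F \<Longrightarrow> g \<in> elems F \<Longrightarrow> (\<lambda>x. f x + g x) \<in> elems F"
  and elems_scale: "c \<in> scal F \<Longrightarrow> f \<in> elems F \<Longrightarrow> (\<lambda>x. c * f x) \<in> elems F"
  and nrm_nonneg: "f \<in> elems F \<Longrightarrow> 0 \<le> nrm F f"
  and nrm_scale: "c \<in> scal F \<Longrightarrow> f \<in> elems F \<Longrightarrow> nrm F (\<lambda>x. c * f x) = cmod c * nrm F f"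
  and nrm_add: "f \<in> elems F \<Longrightarrow> g \<in> elems F \<Longrightarrow> nrm F (\<lambda>x. f x + g x) \<le> nrm F f + nrm F g"
  using normed unfolding normed_fun_space_def by simp_all

lemma nrm_zero [simp]: "nrm F (\<lambda>_. 0) = 0"
  using nrm_scale[of 0 "\<lambda>_. 0"] by simp

lemma elems_uminus: "f \<in> elems F \<Longrightarrow> (\<lambda>x. - f x) \<in> elems F"
  and nrm_uminus: "f \<in> elems F \<Longrightarrow> nrm F (\<lambda>x. - f x) = nrm F f"
  using elems_scale[of "-1" f] nrm_scale[of "-1" f] by simp_all

lemma elems_lincomb:
  assumes "finite I" "\<And>i. i \<in> I \<Longrightarrow> c i \<in> scal F" "\<And>i. i \<in> I \<Longrightarrow> f i \<in> elems F"
  shows "(\<lambda>x. \<Sum>i\<in>I. c i * f i x) \<in> elems F"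
  using assms by (induction rule: finite_induct) (auto intro!: elems_add elems_scale)

lemma nrm_lincomb_le:
  assumes "finite I" "\<And>i. i \<in> I \<Longrightarrow> c i \<in> scal F" "\<And>i. i \<in> I \<Longrightarrow> f i \<in> elems F"
  shows "nrm F (\<lambda>x. \<Sum>i\<in>I. c i * f i x) \<le> (\<Sum>i\<in>I. cmod (c i) * nrm F (f i))"
  using assms
proof (induction rule: finite_induct)
  case (insert j I)
  have "nrm F (\<lambda>x. c j * f j x + (\<Sum>i\<in>I. c i * f i x))
      \<le> nrm F (\<lambda>x. c j * f j x) + nrm F (\<lambda>x. \<Sum>i\<in>I. c i * f i x)"
    using insert by (intro nrm_add elems_scale elems_lincomb) auto
  also have "\<dots> \<le> cmod (c j) * nrm F (f j) + (\<Sum>i\<in>I. cmod (c i) * nrm F (f i))"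
    using insert by (intro add_mono) (auto simp: nrm_scale)
  finally show ?case using insert by simp
qed simp

lemma unit_ball_elems: "f \<in> unit_ball F \<Longrightarrow> f \<in> elems F"
  by (simp add: unit_ball_def)

lemma unit_ball_scaled:
  assumes "f \<in> elems F" "nrm F f \<le> R" "0 < R"
  shows "(\<lambda>x. complex_of_real (1 / R) * f x) \<in> unit_ball F"
proof -
  have "nrm F (\<lambda>x. complex_of_real (1 / R) * f x) = cmod (complex_of_real (1 / R)) * nrm F f"
    using assms(1) by (intro nrm_scale scal_closed)
  also have "\<dots> \<le> 1" using assms(2,3) by (simp add: norm_divide)
  finally have "nrm F (\<lambda>x. complex_of_real (1 / R) * f x) \<le> 1" .
  moreover have "(\<lambda>x. complex_of_real (1 / R) * f x) \<in> elems F"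
    using assms(1) by (intro elems_scale scal_closed)
  ultimately show ?thesis by (simp only: unit_ball_def mem_Collect_eq)
qed

lemma dual_scal: "N \<in> dual F \<Longrightarrow> f \<in> elems F \<Longrightarrow> N f \<in> scal F"
  and dual_add: "N \<in> dual F \<Longrightarrow> f \<in> elems F \<Longrightarrow> g \<in> elems F \<Longrightarrow> N (\<lambda>x. f x + g x) = N f + N g"
  and dual_scale: "N \<in> dual F \<Longrightarrow> c \<in> scal F \<Longrightarrow> f \<in> elems F \<Longrightarrow> N (\<lambda>x. c * f x) = c * N f"
  unfolding dual_def by simp_all

lemma dual_zero: "N \<in> dual F \<Longrightarrow> N (\<lambda>_. 0) = 0"
  using dual_scale[of N 0 "\<lambda>_. 0"] by simp

lemma dual_lincomb:
  assumes "N \<in> dual F"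
    and "finite I" "\<And>i. i \<in> I \<Longrightarrow> c i \<in> scal F" "\<And>i. i \<in> I \<Longrightarrow> f i \<in> elems F"
  shows "N (\<lambda>x. \<Sum>i\<in>I. c i * f i x) = (\<Sum>i\<in>I. c i * N (f i))"
  using assms(2-)
proof (induction rule: finite_induct)
  case empty
  show ?case by (simp add: dual_zero[OF assms(1)])
next
  case (insert j I)
  have "N (\<lambda>x. c j * f j x + (\<Sum>i\<in>I. c i * f i x)) = N (\<lambda>x. c j * f j x) + N (\<lambda>x. \<Sum>i\<in>I. c i * f i x)"
    using insert by (intro dual_add[OF assms(1)] elems_scale elems_lincomb) auto
  then show ?case using insert by (simp add: dual_scale[OF assms(1)])
qed

text \<open>Continuity at 0 gives a ball of radius \<open>r\<close> on which \<open>N\<close> stays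
  below 1 in modulus. Scaling by \<open>r / 2\<close> puts the closed unit ball strictly inside it,
  whence the bound \<open>2 / r\<close>.\<close>

lemma dual_bounded_on_unit_ball:
  assumes N: "N \<in> dual F"
  shows "\<exists>K. \<forall>f\<in>unit_ball F. cmod (N f) \<le> K"
proof -
  interpret M: Metric_space "elems F" "fs_dist F"
    by (rule Metric_space_fs_dist[OF normed])
  have "continuous_map M.mtopology euclidean N" using N by (simp add: dual_def)
  then have "openin M.mtopology {f \<in> topspace M.mtopology. N f \<in> ball 0 1}"
    by (rule openin_continuous_map_preimage) simp
  moreover have "(\<lambda>_. 0) \<in> {f \<in> topspace M.mtopology. N f \<in> ball 0 1}"
    by (simp add: dual_zero[OF N])
  ultimately obtain r where r: "r > 0"
    "M.mball (\<lambda>_. 0) r \<subseteq> {f \<in> topspace M.mtopology. N f \<in> ball 0 1}"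
    unfolding M.openin_mtopology by blast
  have "cmod (N f) \<le> 2 / r" if f: "f \<in> unit_ball F" for f
  proof -
    define c where "c = complex_of_real (r / 2)"
    have fe: "f \<in> elems F" "nrm F f \<le> 1" using f by (auto simp: unit_ball_def)
    have cf: "(\<lambda>x. c * f x) \<in> elems F" unfolding c_def by (intro elems_scale scal_closed fe)
    have "nrm F (\<lambda>x. c * f x) = r / 2 * nrm F f"
      unfolding c_def using r by (subst nrm_scale[OF scal_closed(3) fe(1)]) simp
    also have "\<dots> \<le> r / 2 * 1" using fe r by (intro mult_left_mono) auto
    also have "\<dots> < r" using r by simp
    finally have "(\<lambda>x. c * f x) \<in> M.mball (\<lambda>_. 0) r"
      using cf nrm_uminus[OF cf] by (simp add: M.in_mball fs_dist_def)
    then have "cmod (N (\<lambda>x. c * f x)) < 1" using r by auto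
    also have "N (\<lambda>x. c * f x) = c * N f"
      unfolding c_def by (intro dual_scale N fe scal_closed)
    also have "cmod (c * N f) = r / 2 * cmod (N f)" using r by (simp add: c_def norm_mult)
    finally show ?thesis using r by (simp add: field_simps)
  qed
  then show ?thesis by blast
qed

text \<open>The \<open>f\<^sub>j\<close> nearly maximise \<open>\<bar>det (N\<^sub>i (f\<^sub>j))\<bar>\<close> over the unit ball, so the quotients of
  determinants in Cramer's rule are at most \<open>1 + \<delta>\<close>.\<close>

lemma approximate_auerbach_system:
  fixes n :: nat
  assumes N: "N \<in> {..<n} \<rightarrow> dual F" and \<delta>: "\<delta> > 0"
  obtains r f where "r \<le> n" "f \<in> {..<r} \<rightarrow> unit_ball F"
    "\<And>g. g \<in> unit_ball F \<Longrightarrow> \<exists>c \<in> {..<r} \<rightarrow> scal F. (\<forall>j<r. cmod (c j) \<le> 1 + \<delta>) \<and>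
       (\<forall>i<n. N i (\<lambda>x. g x - (\<Sum>j<r. c j * f j x)) = 0)"
proof -
  \<comment> \<open>A determining set of least cardinality plays the role of a maximal linearly
    independent subfamily of the functionals.\<close>
  define determining where "determining I \<longleftrightarrow> I \<subseteq> {..<n} \<and>
    (\<forall>g\<in>elems F. (\<forall>i\<in>I. N i g = 0) \<longrightarrow> (\<forall>i<n. N i g = 0))" for I
  have "determining {..<n}" by (simp add: determining_def)
  then obtain I where I: "determining I" and min: "\<And>J. determining J \<Longrightarrow> card I \<le> card J"
    using ex_has_least_nat[of determining "{..<n}" card] by blast
  have In: "I \<subseteq> {..<n}" using I by (simp add: determining_def)
  have finI: "finite I" using finite_subset[OF In] by simp
  define r where "r = card I"
  obtain e where e: "bij_betw e {..<r} I"
    using ex_bij_betw_nat_finite[OF finI] by (auto simp: r_def lessThan_atLeast0)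
  have eI: "e k \<in> I" if "k < r" for k using e that by (auto simp: bij_betw_def)
  define M where "M k = N (e k)" for k
  have M: "M k \<in> dual F" if "k < r" for k
    unfolding M_def using eI[OF that] In N by auto
  have M_kernel: "N i g = 0" if "g \<in> elems F" "\<And>k. k < r \<Longrightarrow> M k g = 0" "i < n" for g i
  proof -
    have "\<forall>i\<in>I. N i g = 0" using that(2) e unfolding M_def bij_betw_def by auto
    then show ?thesis using I that by (auto simp: determining_def)
  qed
  define D where "D f = square_det r (\<lambda>i j. M i (f j))" for f :: "nat \<Rightarrow> 'd \<Rightarrow> complex"
  define V where "V = (\<lambda>f. cmod (D f)) ` ({..<r} \<rightarrow> unit_ball F)"

  \<comment> \<open>By minimality, dropping \<open>e k\<close> enlarges the common kernel. A witness
    is killed by every other \<open>M j\<close> but not by \<open>M k\<close>. These witnesses give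
    a diagonal matrix with nonzero determinant, so the supremum of \<open>V\<close> is
    positive.\<close>
  have "\<exists>h\<in>unit_ball F. (\<forall>j<r. j \<noteq> k \<longrightarrow> M j h = 0) \<and> M k h \<noteq> 0" if k: "k < r" for k
  proof -
    have "card (I - {e k}) < card I" using finI eI[OF k] by (intro psubset_card_mono) auto
    then have "\<not> determining (I - {e k})" using min[of "I - {e k}"] by linarith
    then obtain g i where g: "g \<in> elems F" "\<forall>i\<in>I - {e k}. N i g = 0" "i < n" "N i g \<noteq> 0"
      using In unfolding determining_def by blast
    have off: "M j g = 0" if "j < r" "j \<noteq> k" for j
      using g(2) eI[OF that(1)] e that k unfolding M_def bij_betw_def inj_on_def by auto
    then have Mk: "M k g \<noteq> 0" using M_kernel[OF g(1) _ g(3)] g(4) by metis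
    \<comment> \<open>Adding 1 to the norm keeps the denominator positive.\<close>
    define a where "a = complex_of_real (1 / (1 + nrm F g))"
    have a: "a \<noteq> 0" "a \<in> scal F"
      using nrm_nonneg[OF g(1)] unfolding a_def by (simp_all del: of_real_divide)
    have "M j (\<lambda>x. a * g x) = a * M j g" if "j < r" for j
      by (intro dual_scale M that a g)
    moreover have "(\<lambda>x. a * g x) \<in> unit_ball F"
      unfolding a_def using nrm_nonneg[OF g(1)] by (intro unit_ball_scaled g) auto
    ultimately show ?thesis using off Mk a k by (intro bexI[of _ "\<lambda>x. a * g x"]) auto
  qed
  then obtain h where h: "\<And>k. k < r \<Longrightarrow> h k \<in> unit_ball F"
    and h0: "\<And>j k. j < r \<Longrightarrow> k < r \<Longrightarrow> j \<noteq> k \<Longrightarrow> M j (h k) = 0" "\<And>k. k < r \<Longrightarrow> M k (h k) \<noteq> 0"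
    by metis
  have "D h \<noteq> 0"
    unfolding D_def using h0 by (intro square_det_diagonal_nonzero) auto
  moreover have "cmod (D h) \<in> V"
    unfolding V_def using h by (intro imageI) auto
  moreover have bdd: "bdd_above V"
  proof -
    have "\<forall>k\<in>{..<r}. \<exists>K. \<forall>f\<in>unit_ball F. cmod (M k f) \<le> K"
      using dual_bounded_on_unit_ball[OF M] by auto
    then obtain K where K: "\<And>k f. k < r \<Longrightarrow> f \<in> unit_ball F \<Longrightarrow> cmod (M k f) \<le> K k"
      by (metis lessThan_iff)
    have "cmod (D f) \<le> fact r * (\<Sum>k<r. \<bar>K k\<bar>) ^ r" if f: "f \<in> {..<r} \<rightarrow> unit_ball F" for f
      unfolding D_def
    proof (rule square_det_bound)
      fix i j assume ij: "i < r" "j < r"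
      have "cmod (M i (f j)) \<le> \<bar>K i\<bar>" using K[OF ij(1), of "f j"] f ij by fastforce
      also have "\<dots> \<le> (\<Sum>k<r. \<bar>K k\<bar>)" using ij by (intro member_le_sum) auto
      finally show "cmod (M i (f j)) \<le> (\<Sum>k<r. \<bar>K k\<bar>)" .
    qed
    then show ?thesis unfolding V_def by (intro bdd_aboveI2)
  qed
  ultimately have "0 < Sup V"
    by (smt (verit) cSup_upper zero_less_norm_iff)
  \<comment> \<open>The unit ball need not be compact, so the supremum is only approached, up to the
    factor \<open>1 + \<delta>\<close>.\<close>
  then have "Sup V / (1 + \<delta>) < Sup V" using \<delta> by (simp add: field_simps)
  then obtain f where f: "f \<in> {..<r} \<rightarrow> unit_ball F" and Df: "Sup V / (1 + \<delta>) < cmod (D f)"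
    using less_cSup_iff[of V "Sup V / (1 + \<delta>)"] bdd h unfolding V_def by blast
  have D_pos: "0 < cmod (D f)"
    using Df \<open>0 < Sup V\<close> \<delta> by (smt (verit) divide_pos_pos)
  have fe: "f j \<in> elems F" if "j < r" for j using f that by (auto intro: unit_ball_elems)
  show thesis
  proof (rule that[of r f])
    show "r \<le> n" unfolding r_def using card_mono[OF _ In] by simp
    show "f \<in> {..<r} \<rightarrow> unit_ball F" by (fact f)
    fix g assume g: "g \<in> unit_ball F"
    then have ge: "g \<in> elems F" by (rule unit_ball_elems)
    \<comment> \<open>Cramer coefficients of \<open>g\<close>. Each numerator is the determinant of
      the system with \<open>f j\<close> replaced by \<open>g\<close>, again a system in the unit
      ball, so its modulus lies in \<open>V\<close>.\<close>
    define c where "c j = square_det r (\<lambda>i k. if k = j then M i g else M i (f k)) / D f" for j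
    have "c j \<in> scal F" if "j < r" for j
      unfolding c_def D_def
      by (intro scal_closed(8) square_det_scal) (auto intro: dual_scal M fe ge)
    moreover have "cmod (c j) \<le> 1 + \<delta>" if j: "j < r" for j
    proof -
      have "square_det r (\<lambda>i k. if k = j then M i g else M i (f k)) = D (f(j := g))"
        unfolding D_def by (intro square_det_cong) auto
      moreover have "cmod (D (f(j := g))) \<in> V"
        unfolding V_def using f g by (intro imageI) auto
      then have "cmod (D (f(j := g))) \<le> Sup V" by (rule cSup_upper[OF _ bdd])
      ultimately have "cmod (c j) \<le> Sup V / cmod (D f)"
        using D_pos by (simp add: c_def norm_divide divide_right_mono)
      also have "\<dots> \<le> 1 + \<delta>" using Df D_pos \<delta> by (simp add: field_simps)
      finally show ?thesis .
    qed
    \<comment> \<open>Cramer's rule annihilates the residual under the \<open>r\<close> chosen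
      functionals; since these determine the kernel, all \<open>n\<close> functionals vanish
      there.\<close>
    moreover have "N i (\<lambda>x. g x - (\<Sum>j<r. c j * f j x)) = 0" if "i < n" for i
    proof (rule M_kernel[OF _ _ that])
      have sum: "(\<lambda>x. \<Sum>j<r. - c j * f j x) \<in> elems F"
        using calculation(1) fe by (intro elems_lincomb) auto
      have eq: "(\<lambda>x. g x - (\<Sum>j<r. c j * f j x)) = (\<lambda>x. g x + (\<Sum>j<r. - c j * f j x))"
        by (simp add: sum_negf)
      show "(\<lambda>x. g x - (\<Sum>j<r. c j * f j x)) \<in> elems F"
        unfolding eq by (intro elems_add ge sum)
      fix k assume k: "k < r"
      have "M k (\<lambda>x. \<Sum>j<r. - c j * f j x) = (\<Sum>j<r. - c j * M k (f j))"
        using calculation(1) fe by (intro dual_lincomb M k) auto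
      also have "\<dots> = - (\<Sum>j<r. c j * M k (f j))" by (simp add: sum_negf)
      also have "(\<Sum>j<r. c j * M k (f j)) = M k g"
        unfolding c_def D_def using D_pos k by (intro cramer_rule) (auto simp: D_def)
      finally show "M k (\<lambda>x. g x - (\<Sum>j<r. c j * f j x)) = 0"
        unfolding eq using dual_add[OF M[OF k] ge sum] by simp
    qed
    ultimately show "\<exists>c \<in> {..<r} \<rightarrow> scal F. (\<forall>j<r. cmod (c j) \<le> 1 + \<delta>) \<and>
       (\<forall>i<n. N i (\<lambda>x. g x - (\<Sum>j<r. c j * f j x)) = 0)"
      by (intro bexI[of _ c]) auto
  qed
qed

end

subsection \<open>Linear widths and Gelfand widths\<close>

lemma L2_norm_le_worst_case_error:
  assumes "worst_case_error F R = ennreal c" "0 \<le> c" "f \<in> unit_ball F"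
  shows "L2_norm F (\<lambda>x. f x - R f x) \<le> c"
proof -
  have "ennreal (L2_norm F (\<lambda>x. f x - R f x)) \<le> worst_case_error F R"
    unfolding worst_case_error_def by (rule SUP_upper[OF assms(3)])
  then show ?thesis using assms(1,2) by simp
qed

locale L2_embedded_space = normed_function_space +
  assumes elems_L2: "elems F \<subseteq> L2 F"
begin

text \<open>Information that vanishes at \<open>f\<close> cannot separate \<open>f\<close> from \<open>-f\<close>.\<close>

lemma L2_norm_le_of_zero_information:
  assumes \<phi>: "\<phi> \<in> ({..<n} \<rightarrow>\<^sub>E scal F) \<rightarrow> L2 F" and N: "N \<in> {..<n} \<rightarrow> dual F"
    and err: "worst_case_error F (\<lambda>f. \<phi> (\<lambda>i\<in>{..<n}. N i f)) = ennreal c" "0 \<le> c"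
    and f: "f \<in> unit_ball F" and Nf: "\<And>i. i < n \<Longrightarrow> N i f = 0"
  shows "L2_norm F f \<le> c"
proof -
  have fe: "f \<in> elems F" using f by (rule unit_ball_elems)
  define p where "p = \<phi> (\<lambda>i\<in>{..<n}. 0)"
  have p: "p \<in> L2 F" unfolding p_def using \<phi> by (rule funcset_mem) auto
  have fL: "f \<in> L2 F" "(\<lambda>x. - f x) \<in> L2 F" using elems_L2 fe elems_uminus[OF fe] by auto
  have "N i (\<lambda>x. - f x) = 0" if "i < n" for i
    using dual_scale[of "N i" "-1" f] N that fe Nf[OF that] by auto
  then have info: "(\<lambda>i\<in>{..<n}. N i f) = (\<lambda>i\<in>{..<n}. 0)"
    "(\<lambda>i\<in>{..<n}. N i (\<lambda>x. - f x)) = (\<lambda>i\<in>{..<n}. 0)"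
    using Nf by (auto simp: fun_eq_iff)
  have mf: "(\<lambda>x. - f x) \<in> unit_ball F"
    using f nrm_uminus[OF fe] elems_uminus[OF fe] by (simp add: unit_ball_def)
  have "L2_norm F (\<lambda>x. f x - p x) \<le> c" "L2_norm F (\<lambda>x. - f x - p x) \<le> c"
    using L2_norm_le_worst_case_error[OF err f] L2_norm_le_worst_case_error[OF err mf]
    by (simp_all only: info p_def)
  \<comment> \<open>Both functions receive the same reconstruction \<open>p\<close>, which cancels
    in the difference and leaves \<open>2 * f x\<close>.\<close>
  then have "L2_norm F (\<lambda>x. (f x - p x) - (- f x - p x)) \<le> 2 * c"
    by (intro L2_norm_diff_le L2_diff fL p)
  also have "(\<lambda>x. (f x - p x) - (- f x - p x)) = (\<lambda>x. 2 * f x)" by auto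
  finally show ?thesis by (simp add: L2_norm_scale)
qed

text \<open>Subtracting the Auerbach combination from \<open>g\<close> leaves a function with zero
  information and norm at most \<open>R = 1 + n (1 + \<delta>)\<close>. Scaled into the unit ball
  its \<open>L2\<close> norm is at most \<open>c\<close>, so unscaled it is at most
  \<open>R * c\<close>.\<close>

lemma linear_width_le_worst_case_error:
  assumes \<phi>: "\<phi> \<in> ({..<n} \<rightarrow>\<^sub>E scal F) \<rightarrow> L2 F" and N: "N \<in> {..<n} \<rightarrow> dual F"
    and err: "worst_case_error F (\<lambda>f. \<phi> (\<lambda>i\<in>{..<n}. N i f)) = ennreal c" "0 \<le> c"
    and \<delta>: "\<delta> > 0"
  shows "linear_width F n \<le> ennreal ((1 + real n * (1 + \<delta>)) * c)"
proof -
  obtain r f where r: "r \<le> n" and f: "f \<in> {..<r} \<rightarrow> unit_ball F"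
    and rep: "\<And>g. g \<in> unit_ball F \<Longrightarrow> \<exists>c \<in> {..<r} \<rightarrow> scal F. (\<forall>j<r. cmod (c j) \<le> 1 + \<delta>) \<and>
       (\<forall>i<n. N i (\<lambda>x. g x - (\<Sum>j<r. c j * f j x)) = 0)"
    by (rule approximate_auerbach_system[OF N \<delta>]) (rule that)
  have fe: "f j \<in> elems F" and f1: "nrm F (f j) \<le> 1" if "j < r" for j
    using f that by (auto simp: unit_ball_def)
  then have fL: "f \<in> {..<r} \<rightarrow> L2 F" using elems_L2 by auto
  obtain T where T: "bounded_linear_L2 F T" "rank_le F r T"
    and best: "\<And>g c. g \<in> L2 F \<Longrightarrow> c \<in> {..<r} \<rightarrow> scal F \<Longrightarrow>
      L2_norm F (\<lambda>x. g x - T g x) \<le> L2_norm F (\<lambda>x. g x - (\<Sum>j<r. c j * f j x))"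
    by (rule best_approximation_operator[OF fL]) (rule that)
  define R where "R = 1 + real n * (1 + \<delta>)"
  have R: "R > 0" using \<delta> by (simp add: R_def add_pos_nonneg)
  have "L2_norm F (\<lambda>x. g x - T g x) \<le> R * c" if g: "g \<in> unit_ball F" for g
  proof -
    have ge: "g \<in> elems F" "nrm F g \<le> 1" using g by (auto simp: unit_ball_def)
    obtain a where a: "a \<in> {..<r} \<rightarrow> scal F" and a_le: "\<forall>j<r. cmod (a j) \<le> 1 + \<delta>"
      and ker: "\<forall>i<n. N i (\<lambda>x. g x - (\<Sum>j<r. a j * f j x)) = 0"
      using rep[OF g] by (elim bexE conjE) (rule that)
    define h where "h x = g x - (\<Sum>j<r. a j * f j x)" for x
    have h_eq: "h = (\<lambda>x. g x + (\<Sum>j<r. - a j * f j x))"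
      by (auto simp: h_def sum_negf)
    have sum: "(\<lambda>x. \<Sum>j<r. - a j * f j x) \<in> elems F"
      using a fe by (intro elems_lincomb) auto
    have h: "h \<in> elems F" unfolding h_eq by (intro elems_add ge sum)
    have "nrm F h \<le> nrm F g + nrm F (\<lambda>x. \<Sum>j<r. - a j * f j x)"
      unfolding h_eq by (intro nrm_add ge sum)
    also have "nrm F (\<lambda>x. \<Sum>j<r. - a j * f j x) \<le> (\<Sum>j<r. cmod (- a j) * nrm F (f j))"
      using a fe by (intro nrm_lincomb_le) auto
    also have "\<dots> \<le> (\<Sum>j<r. (1 + \<delta>) * 1)"
      using a_le[rule_format] f1 fe \<delta> by (intro sum_mono mult_mono) (auto intro: nrm_nonneg)
    also have "\<dots> \<le> real n * (1 + \<delta>)" using r \<delta> by (simp add: mult_right_mono)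
    finally have "nrm F h \<le> R" using ge by (simp add: R_def)
    then have ball: "(\<lambda>x. complex_of_real (1 / R) * h x) \<in> unit_ball F"
      by (rule unit_ball_scaled[OF h _ R])
    have "N i (\<lambda>x. complex_of_real (1 / R) * h x) = 0" if "i < n" for i
    proof -
      have "N i (\<lambda>x. complex_of_real (1 / R) * h x) = complex_of_real (1 / R) * N i h"
        using N that by (intro dual_scale scal_closed h) auto
      then show ?thesis using ker that by (simp add: h_def[abs_def])
    qed
    then have "L2_norm F (\<lambda>x. complex_of_real (1 / R) * h x) \<le> c"
      by (rule L2_norm_le_of_zero_information[OF \<phi> N err ball])
    then have "L2_norm F h \<le> R * c"
      using R unfolding L2_norm_scale by (simp add: norm_divide field_simps)
    \<comment> \<open>The coefficients \<open>a\<close> may depend on \<open>g\<close> in any way;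
      linearity comes from the projection \<open>T\<close>, which does at least as well.\<close>
    moreover have "L2_norm F (\<lambda>x. g x - T g x) \<le> L2_norm F h"
      unfolding h_def using best[of g a] elems_L2 ge a by auto
    ultimately show ?thesis by simp
  qed
  then have "worst_case_error F T \<le> ennreal (R * c)"
    unfolding worst_case_error_def by (intro SUP_least ennreal_leI)
  moreover have "linear_width F n \<le> worst_case_error F T"
    unfolding linear_width_def using T rank_le_mono[OF T(2) r] by (intro INF_lower) auto
  ultimately show ?thesis by (simp add: R_def)
qed

text \<open>One parameter \<open>t\<close> is both the slack in the infimum over algorithms and the
  slack in the Auerbach coefficients; letting it tend to 0 from the right removes both.\<close>

lemma linear_width_le_gelfand_width:
  assumes "gelfand_width F n \<le> ennreal c" "0 \<le> c"
  shows "linear_width F n \<le> ennreal ((1 + real n) * c)"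
proof (rule tendsto_lowerbound)
  have "((\<lambda>t. (1 + real n * (1 + t)) * (c + t)) \<longlongrightarrow> (1 + real n * (1 + 0)) * (c + 0)) (at_right 0)"
    by (intro tendsto_intros)
  then show "((\<lambda>t. ennreal ((1 + real n * (1 + t)) * (c + t))) \<longlongrightarrow> ennreal ((1 + real n) * c)) (at_right 0)"
    by (intro tendsto_ennrealI) simp
  have "linear_width F n \<le> ennreal ((1 + real n * (1 + t)) * (c + t))" if t: "t > 0" for t
  proof -
    have "gelfand_width F n < ennreal (c + t)"
      using assms t by (simp add: ennreal_less_iff order.strict_trans1)
    then obtain \<phi> N where \<phi>: "\<phi> \<in> ({..<n} \<rightarrow>\<^sub>E scal F) \<rightarrow> L2 F" and N: "N \<in> {..<n} \<rightarrow> dual F"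
      and less: "worst_case_error F (\<lambda>f. \<phi> (\<lambda>i\<in>{..<n}. N i f)) < ennreal (c + t)"
      unfolding gelfand_width_def INF_less_iff by auto
    obtain d where d: "worst_case_error F (\<lambda>f. \<phi> (\<lambda>i\<in>{..<n}. N i f)) = ennreal d" "0 \<le> d"
      using less by (cases "worst_case_error F (\<lambda>f. \<phi> (\<lambda>i\<in>{..<n}. N i f))") auto
    then have "d \<le> c + t" using less by (simp add: ennreal_less_iff)
    have "linear_width F n \<le> ennreal ((1 + real n * (1 + t)) * d)"
      by (rule linear_width_le_worst_case_error[OF \<phi> N d t])
    also have "\<dots> \<le> ennreal ((1 + real n * (1 + t)) * (c + t))"
      using \<open>d \<le> c + t\<close> t by (intro ennreal_leI mult_left_mono) auto
    finally show ?thesis .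
  qed
  then show "\<forall>\<^sub>F t in at_right 0. linear_width F n \<le> ennreal ((1 + real n * (1 + t)) * (c + t))"
    by (auto simp: eventually_at_filter)
qed simp

end

section \<open>From widths to least indices\<close>

lemma min_index_le_iff:
  "min_index w \<epsilon> \<le> enat k \<longleftrightarrow> (\<exists>m. 1 \<le> m \<and> m \<le> k \<and> w m \<le> ennreal \<epsilon>)"
proof
  assume "min_index w \<epsilon> \<le> enat k"
  \<comment> \<open>A strict bound on the infimum yields a witness, and it excludes the empty set,
    whose infimum is infinite.\<close>
  also have "enat k < enat (Suc k)" by simp
  finally show "\<exists>m. 1 \<le> m \<and> m \<le> k \<and> w m \<le> ennreal \<epsilon>"
    unfolding min_index_def Inf_less_iff by auto
next
  assume "\<exists>m. 1 \<le> m \<and> m \<le> k \<and> w m \<le> ennreal \<epsilon>"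
  then obtain m where "1 \<le> m" "m \<le> k" "w m \<le> ennreal \<epsilon>" by blast
  then show "min_index w \<epsilon> \<le> enat k"
    unfolding min_index_def by (intro Inf_lower2[of "enat m"]) auto
qed

lemma min_index_mono:
  assumes "\<And>n. v n \<le> w n"
  shows "min_index v \<epsilon> \<le> min_index w \<epsilon>"
  unfolding min_index_def using assms by (intro Inf_superset_mono) (auto intro: order_trans)

subsection \<open>Tail estimates\<close>

text \<open>This is where the factor \<open>1 + B ^ 3\<close> of the final constant earns its form:
  since \<open>2 powr (1 / B)\<close> is at least \<open>1 + 2 / (3 * B)\<close>, the product of the
  two dominates \<open>1 + B + B^2\<close>.\<close>

lemma polynomial_dominated_by_one_plus_cube:
  fixes B :: real
  assumes "B > 0"
  shows "1 + B + B\<^sup>2 \<le> (1 + 2 / (3 * B)) * (1 + B ^ 3)"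
proof -
  \<comment> \<open>Multiplying the difference of both sides by \<open>3 * B\<close> gives this
    quartic; the identity writes it as a sum of squares plus a positive constant.\<close>
  have "3 * B ^ 4 - B ^ 3 - 3 * B\<^sup>2 + 2
      = 3 * (B\<^sup>2 - B / 6 - 3 / 5)\<^sup>2 + (B - 3 / 5)\<^sup>2 / 2 + B\<^sup>2 / 60 + 37 / 50"
    by (simp add: power2_eq_square power3_eq_cube power4_eq_xxxx field_simps)
  then have "0 \<le> 3 * B ^ 4 - B ^ 3 - 3 * B\<^sup>2 + 2"
    by (smt (verit) zero_le_power2 divide_nonneg_pos)
  then show ?thesis
    using assms by (simp add: power2_eq_square power3_eq_cube power4_eq_xxxx field_simps)
qed

text \<open>Here \<open>x0\<close> is the value of \<open>(k / A) powr (1 / B)\<close> at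
  \<open>k = 2 * A * (K * L) powr B\<close>. The first inequality is the logarithm of the tail
  estimate at its starting point; \<open>3 * B \<le> x0\<close> lets it persist for larger
  arguments.\<close>

lemma exponent_dominates_logarithms:
  fixes A B L :: real
  assumes "B > 0" "A \<ge> 1" "L \<ge> 1"
  defines "K \<equiv> ln (36 * A) * (1 + B ^ 3)"
  defines "x0 \<equiv> 2 powr (1 / B) * (K * L)"
  shows "ln A + B * ln x0 + ln (16/9) + L \<le> x0" and "3 * B \<le> x0" and "3 \<le> K" and "3 \<le> x0"
proof -
  define l where "l = ln (36 * A)"
  define M where "M = 1 + B ^ 3"
  have exp3: "exp 3 \<le> (27::real)"
  proof -
    have "exp 3 = (exp 1 :: real) ^ 3" by (simp flip: exp_of_nat_mult)
    also have "\<dots> \<le> 3 ^ 3" by (intro power_mono exp_le) auto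
    finally show ?thesis by simp
  qed
  have l3: "l \<ge> 3"
    unfolding l_def using assms exp3 by (subst ln_ge_iff) auto
  have M1: "M \<ge> 1" using assms by (simp add: M_def)
  have KlM: "K = l * M" by (simp add: K_def l_def M_def)
  have l_le_K: "l \<le> K" using M1 l3 by (simp add: KlM)
  show K3: "3 \<le> K" using l_le_K l3 by simp
  define t where "t = 2 powr (1 / B)"
  have t: "t \<ge> 1 + 2 / (3 * B)"
  proof -
    have "1 + 2 / (3 * B) \<le> 1 + ln 2 / B"
      using ln2_ge_two_thirds assms by (simp add: field_simps)
    also have "\<dots> \<le> exp (ln 2 / B)" by (rule exp_ge_add_one_self)
    also have "\<dots> = t" by (simp add: t_def powr_def)
    finally show ?thesis .
  qed
  have t1: "t \<ge> 1" using t assms(1) by (smt (verit) divide_pos_pos)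
  have tM: "1 + B + B\<^sup>2 \<le> t * M"
    using polynomial_dominated_by_one_plus_cube[OF assms(1)] mult_right_mono[OF t, of M] M1
    by (simp add: M_def)
  have B2: "0 < B\<^sup>2" using assms by simp
  have tK: "t * K \<ge> l * (1 + B + B\<^sup>2)"
    using mult_left_mono[OF tM, of l] l3 by (simp add: KlM mult_ac)
  have tK': "t * K \<ge> 3 * (1 + B + B\<^sup>2)"
    using tK mult_right_mono[OF l3, of "1 + B + B\<^sup>2"] assms B2 by linarith
  have x0: "x0 = t * K * L" by (simp add: x0_def t_def)
  have "0 \<le> 3 * (1 + B + B\<^sup>2)" using assms(1) by simp
  then have "0 \<le> t * K" using tK' by (rule order_trans)
  then have x0_ge: "x0 \<ge> t * K" using mult_left_mono[OF assms(3), of "t * K"] by (simp add: x0)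
  have "3 + 3 * B + 3 * B\<^sup>2 \<le> x0" using x0_ge tK' by (simp add: distrib_left)
  then show "3 * B \<le> x0" and "3 \<le> x0" using B2 assms(1) by (smt (verit))+
  have lnM: "ln M \<le> 3 * B"
  proof -
    have "M \<le> (1 + B) ^ 3" using assms by (simp add: M_def power3_eq_cube algebra_simps)
    then have "ln M \<le> ln ((1 + B) ^ 3)" using M1 by (subst ln_le_cancel_iff) (use assms in auto)
    also have "\<dots> = 3 * ln (1 + B)" using assms by (subst ln_realpow) auto
    also have "\<dots> \<le> 3 * B" using ln_add_one_self_le_self[of B] assms by simp
    finally show ?thesis .
  qed
  have "ln x0 = ln t + ln l + ln M + ln L"
    using assms(3) l3 M1 t1 by (simp add: x0 KlM ln_mult)
  moreover have "B * ln t = ln 2" using assms by (simp add: t_def ln_powr)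
  ultimately have e: "B * ln x0 = ln 2 + B * ln l + B * ln M + B * ln L"
    by (simp add: distrib_left)
  \<comment> \<open>The constant 36 leaves room here, as \<open>3 * 2 * 16/9\<close> is below it; it
    also exceeds the 27 needed for \<open>l \<ge> 3\<close>.\<close>
  have "1 + ln A + ln 2 + ln (16/9) \<le> l"
  proof -
    have "exp 1 * (A * 2 * (16/9)) \<le> 3 * (A * 2 * (16/9))"
      using exp_le assms by (intro mult_right_mono) auto
    then have "ln (exp 1 * (A * 2 * (16/9))) \<le> ln (36 * A)"
      using assms by (subst ln_le_cancel_iff) auto
    moreover have "ln (exp 1 * (A * 2 * (16/9))) = 1 + ln A + ln 2 + ln (16/9)"
      using assms by (simp only: ln_mult ln_exp) (simp add: ln_mult)
    ultimately show ?thesis by (simp add: l_def)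
  qed
  moreover have "B * ln l \<le> B * l"
    using ln_le_minus_one[of l] l3 assms by (intro mult_left_mono) auto
  moreover have "B * ln M \<le> l * B\<^sup>2"
  proof -
    have "B * ln M \<le> B * (3 * B)" using lnM assms(1) by (intro mult_left_mono) auto
    also have "\<dots> = 3 * B\<^sup>2" by (simp add: power2_eq_square)
    also have "\<dots> \<le> l * B\<^sup>2" using l3 by (intro mult_right_mono) auto
    finally show ?thesis .
  qed
  moreover have "B * ln L \<le> B * (L - 1)"
    using ln_le_minus_one[of L] assms by (intro mult_left_mono) auto
  \<comment> \<open>Split \<open>x0\<close> as \<open>t * K + (L - 1) * (t * K)\<close>: the first
    summand absorbs \<open>l * (1 + B + B^2)\<close>, the second all growth in
    \<open>L\<close>.\<close>
  moreover have "(L - 1) * (1 + B) \<le> (L - 1) * (t * K)"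
  proof (intro mult_left_mono)
    show "1 + B \<le> t * K" using tK' B2 assms(1) unfolding distrib_left by (smt (verit))
  qed (use assms(3) in auto)
  ultimately show "ln A + B * ln x0 + ln (16/9) + L \<le> x0"
    using tK x0 e by (simp add: algebra_simps)
qed

text \<open>In logarithmic form the estimate holds at \<open>x0\<close>, and it is carried from
  \<open>x0\<close> to \<open>x\<close> (index \<open>n\<close>) and on to \<open>u\<close> (index
  \<open>k\<close>) because \<open>z - c * ln z\<close> increases for \<open>z \<ge> c\<close>. The
  right-hand side is shaped to telescope over \<open>k\<close>.\<close>

lemma weighted_exp_tail_bound:
  fixes A B L :: real and n k :: nat
  assumes "B > 0" "A \<ge> 1" "L \<ge> 1"
  defines "t \<equiv> 3 * A * (ln (36 * A) * (1 + B ^ 3) * L) powr B"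
  assumes n: "n = nat \<lfloor>t\<rfloor>" and "n \<le> k"
  shows "3 \<le> n" and "1 < (real k / A) powr (1 / B)"
    and "(1 + real k) * exp (1 - (real k / A) powr (1 / B))
           \<le> (real n)\<^sup>2 * exp (1 - L) / (real k * (real k + 1))"
proof -
  define K where "K = ln (36 * A) * (1 + B ^ 3)"
  define x0 where "x0 = 2 powr (1 / B) * (K * L)"
  note mb = exponent_dominates_logarithms[OF assms(1-3), folded K_def, folded x0_def]
  have KL1: "K * L \<ge> 1" using mb(3) assms(3) mult_mono[of 1 K 1 L] by simp
  have KLp: "(K * L) powr B \<ge> 1" using KL1 assms by (simp add: ge_one_powr_ge_zero)
  have AKL: "A * (K * L) powr B \<ge> 1" using KLp assms mult_mono[of 1 A 1 "(K * L) powr B"] by simp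
  have t: "t = 3 * (A * (K * L) powr B)" by (simp add: t_def K_def)
  have t3: "t \<ge> 3" using t AKL by simp
  show n3: "3 \<le> n" using t3 unfolding n by (simp add: le_nat_iff le_floor_iff)
  have "real n > t - 1" using t3 unfolding n by linarith
  \<comment> \<open>Rounding down costs less than 1, at most a third of \<open>t\<close> because
    \<open>t \<ge> 3\<close>. So the factor 3 drops to 2, the 2 in \<open>x0\<close>.\<close>
  then have n2: "real n \<ge> 2 * (A * (K * L) powr B)" using t t3 by linarith
  define x where "x = (real n / A) powr (1 / B)"
  define u where "u = (real k / A) powr (1 / B)"
  have "x0 = (2 * (K * L) powr B) powr (1 / B)"
    using KL1 assms(1) by (simp add: x0_def powr_mult[of 2] powr_powr)
  also have "\<dots> \<le> x"
    unfolding x_def using n2 assms KL1 by (intro powr_mono2) (auto simp: field_simps)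
  finally have x: "x0 \<le> x" .
  have kn: "real k \<ge> 3" "real n \<ge> 3" using n3 assms(6) by auto
  have "real n / A \<le> real k / A" using assms(2,6) by (intro divide_right_mono) auto
  then have xu: "x \<le> u"
    unfolding x_def u_def using assms(1,2) by (intro powr_mono2) auto
  have pos: "x0 > 0" "x > 0" "u > 0" using mb(4) x xu by auto
  show "1 < (real k / A) powr (1 / B)" using mb(4) x xu unfolding u_def by linarith
  have ln_u: "B * ln u = ln (real k) - ln A"
    using assms(1,2) kn by (simp add: u_def ln_powr ln_div)
  have ln_x: "B * ln x = ln (real n) - ln A"
    using assms(1,2) kn by (simp add: x_def ln_powr ln_div)
  have mono: "c * (ln z - ln y) \<le> z - y" if "c \<ge> 0" "c \<le> y" "0 < y" "y \<le> z" for c y z :: real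
  proof -
    have "ln z - ln y \<le> z / y - 1"
      using ln_le_minus_one[of "z / y"] that by (simp add: ln_div)
    then have "c * (ln z - ln y) \<le> c * (z / y - 1)" using that by (intro mult_left_mono) auto
    also have "\<dots> \<le> y * (z / y - 1)" using that by (intro mult_right_mono) auto
    also have "\<dots> = z - y" using that by (simp add: field_simps)
    finally show ?thesis .
  qed
  \<comment> \<open>The weight \<open>3 * B\<close> matches the cube of \<open>k\<close>, since
    \<open>B * ln u = ln k - ln A\<close>; from \<open>x0\<close> to \<open>x\<close> weight
    \<open>B\<close> is enough, as two of the three powers of \<open>n\<close> stay on the
    right.\<close>
  have "3 * B * (ln u - ln x) \<le> u - x" using mono[of "3 * B" x u] mb(2) x xu pos assms by auto
  moreover have "B * (ln x - ln x0) \<le> x - x0" using mono[of B x0 x] mb(2) x xu pos assms by auto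
  ultimately have "ln (16/9) + 3 * ln (real k) - u \<le> 2 * ln (real n) - L"
    using mb(1) ln_u ln_x by (simp add: algebra_simps)
  then have "exp (ln (16/9) + 3 * ln (real k) - u) \<le> exp (2 * ln (real n) - L)" by simp
  moreover have "exp (ln (16/9) + 3 * ln (real k) - u) = 16/9 * real k ^ 3 * exp (- u)"
    using kn exp_of_nat_mult[of 3 "ln (real k)"]
    by (simp add: exp_add exp_diff exp_minus field_simps)
  moreover have "exp (2 * ln (real n) - L) = (real n)\<^sup>2 * exp (- L)"
    using kn exp_of_nat_mult[of 2 "ln (real n)"]
    by (simp add: exp_add exp_diff exp_minus field_simps)
  ultimately have main: "16/9 * real k ^ 3 * exp (- u) \<le> (real n)\<^sup>2 * exp (- L)" by simp
  \<comment> \<open>Source of the constant \<open>16/9\<close>: \<open>1 + k\<close> is at most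
    \<open>4/3 * k\<close> once \<open>k \<ge> 3\<close>.\<close>
  have "(1 + real k)\<^sup>2 \<le> (4/3 * real k)\<^sup>2" using kn by (intro power_mono) auto
  then have "(1 + real k)\<^sup>2 * (real k * exp (- u)) \<le> (4/3 * real k)\<^sup>2 * (real k * exp (- u))"
    by (intro mult_right_mono) auto
  also have "\<dots> = 16/9 * real k ^ 3 * exp (- u)" by (simp add: power2_eq_square power3_eq_cube)
  also note main
  finally have "(1 + real k)\<^sup>2 * (real k * exp (- u)) \<le> (real n)\<^sup>2 * exp (- L)" .
  then have "(1 + real k)\<^sup>2 * (real k * exp (- u)) * exp 1 \<le> (real n)\<^sup>2 * exp (- L) * exp 1"
    by (intro mult_right_mono) auto
  also have "(1 + real k)\<^sup>2 * (real k * exp (- u)) * exp 1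
      = (1 + real k) * exp (1 - u) * (real k * (real k + 1))"
    by (simp add: exp_diff exp_minus power2_eq_square field_simps)
  also have "(real n)\<^sup>2 * exp (- L) * exp 1 = (real n)\<^sup>2 * exp (1 - L)"
    by (simp add: exp_diff exp_minus field_simps)
  finally show "(1 + real k) * exp (1 - (real k / A) powr (1 / B))
           \<le> (real n)\<^sup>2 * exp (1 - L) / (real k * (real k + 1))"
    using kn unfolding u_def[symmetric] by (subst pos_le_divide_eq) auto
qed

lemma inverse_consecutive_products_sums:
  fixes c :: real
  assumes "n > 0"
  shows "(\<lambda>k. c / (real (n + k) * (real (n + k) + 1))) sums (c / real n)"
proof -
  have "(\<lambda>k. 1 / real (n + k)) \<longlonglongrightarrow> 0"
    using LIMSEQ_ignore_initial_segment[OF lim_1_over_n, of n] by (simp add: add.commute)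
  from sums_mult[OF telescope_sums'[OF this], of c]
  have "(\<lambda>k. c * (1 / real (n + k) - 1 / real (n + Suc k))) sums (c / real n)" by simp
  moreover have "c * (1 / real (n + k) - 1 / real (n + Suc k)) = c / (real (n + k) * (real (n + k) + 1))" for k
    using assms by (simp add: field_simps)
  ultimately show ?thesis by simp
qed

section \<open>From the decay of Gelfand widths to the number of samples\<close>

theorem theorem4:
  fixes F :: "'d fun_space" and b :: nat and A B :: real
  assumes "b \<ge> 1"
    and "\<And>(G :: 'd fun_space) (n :: nat). class_A G \<Longrightarrow> n \<ge> 2 \<Longrightarrow>
           linear_sampling_width G (b * n) \<le> 1 / of_nat n * (\<Sum>k. linear_width G (n + k))"
    and "class_A F"
    and "B > 0" and "A \<ge> 1"
    and "\<And>\<epsilon> :: real. 0 < \<epsilon> \<Longrightarrow> \<epsilon> < 1 \<Longrightarrow>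
           ereal_of_enat (n_all \<epsilon> F) \<le> ereal (A * (1 + ln (1 / \<epsilon>)) powr B)"
  shows "\<forall>\<epsilon> :: real. 0 < \<epsilon> \<and> \<epsilon> < 1 \<longrightarrow>
           n_std \<epsilon> F \<le> n_std_lin \<epsilon> F \<and>
           ereal_of_enat (n_std_lin \<epsilon> F) \<le>
             ereal (3 * real b * A * (ln (36 * A) * (1 + B ^ 3)) powr B * (1 + ln (1 / \<epsilon>)) powr B)"
proof (intro allI impI)
  fix \<epsilon> :: real assume \<epsilon>: "0 < \<epsilon> \<and> \<epsilon> < 1"
  interpret L2_embedded_space F
    using assms(3) by unfold_locales (simp_all add: class_A_def continuously_embedded_L2_def)
  define L where "L = 1 + ln (1 / \<epsilon>)"
  have L: "L \<ge> 1" using \<epsilon> by (simp add: L_def)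
  have exp_L: "exp (1 - L) = \<epsilon>" using \<epsilon> by (simp add: L_def ln_div)
  \<comment> \<open>The claimed bound is exactly \<open>b * t\<close>, so rounding \<open>t\<close>
    down keeps \<open>b * n\<close> sample points within it.\<close>
  define t where "t = 3 * A * (ln (36 * A) * (1 + B ^ 3) * L) powr B"
  define n where "n = nat \<lfloor>t\<rfloor>"
  note tail = weighted_exp_tail_bound[OF assms(4,5) L, folded t_def, OF n_def]
  have n3: "3 \<le> n" using tail(1)[of n] by simp
  have width: "linear_width F k \<le> ennreal ((real n)\<^sup>2 * \<epsilon> / (real k * (real k + 1)))"
    if k: "n \<le> k" for k
  proof -
    define u where "u = (real k / A) powr (1 / B)"
    \<comment> \<open>The accuracy at which the hypothesis allows exactly \<open>k\<close>
      functionals; it is below 1 because \<open>u > 1\<close>.\<close>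
    define \<eta> where "\<eta> = exp (1 - u)"
    have u: "1 < u" using tail(2)[OF k] by (simp add: u_def)
    have "u powr B = real k / A" using assms(4,5) by (simp add: u_def powr_powr)
    then have "A * (1 + ln (1 / \<eta>)) powr B = real k"
      using assms(5) by (simp add: \<eta>_def ln_div)
    then have "ereal_of_enat (n_all \<eta> F) \<le> ereal_of_enat (enat k)"
      using assms(6)[of \<eta>] u by (simp add: \<eta>_def)
    then obtain m where m: "m \<le> k" "gelfand_width F m \<le> ennreal \<eta>"
      unfolding ereal_of_enat_le_iff n_all_def min_index_le_iff by blast
    \<comment> \<open>The hypothesis supplies only some index \<open>m \<le> k\<close>, so
      monotonicity of the linear widths brings the estimate to \<open>k\<close>.\<close>
    have "linear_width F k \<le> linear_width F m" by (rule linear_width_antimono[OF m(1)])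
    also have "\<dots> \<le> ennreal ((1 + real m) * \<eta>)"
      using m(2) by (rule linear_width_le_gelfand_width) (simp add: \<eta>_def)
    also have "\<dots> \<le> ennreal ((1 + real k) * \<eta>)"
      using m(1) by (intro ennreal_leI mult_right_mono) (auto simp: \<eta>_def)
    also have "\<dots> \<le> ennreal ((real n)\<^sup>2 * \<epsilon> / (real k * (real k + 1)))"
      using tail(3)[OF k] by (intro ennreal_leI) (simp only: \<eta>_def u_def exp_L)
    finally show ?thesis .
  qed
  \<comment> \<open>The tail telescopes to \<open>n * \<epsilon>\<close>, and the average over
    \<open>n\<close> in the assumed inequality turns this into \<open>\<epsilon>\<close>.\<close>
  have "(\<Sum>k. linear_width F (n + k))
      \<le> (\<Sum>k. ennreal ((real n)\<^sup>2 * \<epsilon> / (real (n + k) * (real (n + k) + 1))))"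
    by (intro suminf_le width) auto
  also have "\<dots> = ennreal ((real n)\<^sup>2 * \<epsilon> / real n)"
    using n3 \<epsilon> by (intro suminf_ennreal_eq inverse_consecutive_products_sums) auto
  also have "(real n)\<^sup>2 * \<epsilon> / real n = real n * \<epsilon>" by (simp add: power2_eq_square)
  finally have sum: "(\<Sum>k. linear_width F (n + k)) \<le> ennreal (real n * \<epsilon>)" .
  have "linear_sampling_width F (b * n) \<le> 1 / of_nat n * (\<Sum>k. linear_width F (n + k))"
    using n3 by (intro assms(2,3)) auto
  also have "\<dots> \<le> 1 / of_nat n * ennreal (real n * \<epsilon>)" by (intro mult_left_mono sum) auto
  also have "1 / of_nat n = ennreal (1 / real n)"
    using n3 by (simp add: ennreal_of_nat_eq_real_of_nat divide_ennreal flip: ennreal_1)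
  also have "ennreal (1 / real n) * ennreal (real n * \<epsilon>) = ennreal \<epsilon>"
    using n3 \<epsilon> by (simp flip: ennreal_mult)
  finally have "n_std_lin \<epsilon> F \<le> enat (b * n)"
    unfolding n_std_lin_def min_index_le_iff using assms(1) n3 by (intro exI[of _ "b * n"]) auto
  then have "ereal_of_enat (n_std_lin \<epsilon> F) \<le> ereal_of_enat (enat (b * n))"
    by (simp only: ereal_of_enat_le_iff)
  also have "\<dots> \<le> ereal (real b * t)"
  proof -
    have "real n \<le> t" using n3 unfolding n_def by linarith
    then show ?thesis by (simp add: mult_left_mono)
  qed
  also have "real b * t
      = 3 * real b * A * (ln (36 * A) * (1 + B ^ 3)) powr B * (1 + ln (1 / \<epsilon>)) powr B"
    using assms(4,5) L by (simp add: t_def powr_mult flip: L_def)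
  finally show "n_std \<epsilon> F \<le> n_std_lin \<epsilon> F \<and> ereal_of_enat (n_std_lin \<epsilon> F) \<le>
      ereal (3 * real b * A * (ln (36 * A) * (1 + B ^ 3)) powr B * (1 + ln (1 / \<epsilon>)) powr B)"
    unfolding n_std_def n_std_lin_def
    by (intro conjI min_index_mono sampling_width_le_linear_sampling_width)
qed

end
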